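(* Let $\Theta\subset\mathbb{R}^m$ and $f:\mathbb{R}^n\times\Theta\to\mathbb{R}$ satisfy the regularity and definability assumptions (see context), and let $O\subset\Theta$ be open and definable. For every $\varepsilon>0$, let $J_{x^\star_\varepsilon}$ be a conservative Jacobian of $\theta\mapsto x^\star_\varepsilon(\theta)$ on $O$. Suppose that, for every compact set $K\subset O$, there exist $C_K>0$ and $\varepsilon_K>0$ such that $$\sup\{\|V\|:\theta\in K,\ 0<\varepsilon\le\varepsilon_K,\ V\in J_{x^\star_\varepsilon}(\theta)\}\le C_K.\qquad(\ast)$$ Then $x^\star_{\min}$ is locally Lipschitz on $O$, the joint selection $x^\star:(\theta,\varepsilon)\mapsto x^\star_\varepsilon(\theta)$ for $\varepsilon>0$, $(\theta,0)\mapsto x^\star_{\min}(\theta)$, is continuous on $O\times\mathbb{R}_+$, and $x^\star_\varepsilon\to x^\star_{\min}$ uniformly on compact subsets of $O$ as $\varepsilon\to0^+$. Moreover, if the uniform range condition (see context) holds on $O$ for some $\bar\varepsilon>0$ and a definable conservative Jacobian $J_F$ of $F=\nabla_xf$, and if for $0<\varepsilon\le\bar\varepsilon$ one chooses $$J_{x^\star_\varepsilon}(\theta)=\{-(H_\varepsilon+\varepsilon I_n)^{-1}M_\varepsilon:(H_\varepsilon\ M_\varepsilon)\in J_F(x^\star_\varepsilon(\theta),\theta)\},$$ then $(\ast)$ holds with $\varepsilon_K=\bar\varepsilon$ for every compact $K\subset O$, and consequently $x^\star_{\min}$ is locally Lipschitz on $O$, the joint selection $x^\star$ is continuous on $O\times\mathbb{R}_+$,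 and $x^\star_\varepsilon\to x^\star_{\min}$ uniformly on compact subsets of $O$ as $\varepsilon\to0^+$.
   Context: Definability is relative to a fixed o-minimal structure expanding the real field; a (set-valued) map is definable if its graph is. $\|\cdot\|$ is the Euclidean norm for vectors and the operator norm for matrices. Conservative Jacobian: for $U\subset\mathbb{R}^d$ open and $G:U\to\mathbb{R}^q$ locally Lipschitz, $J_G:U\rightrightarrows\mathbb{R}^{q\times d}$ is a conservative Jacobian of $G$ on $U$ if it is nonempty-valued, locally bounded, has closed graph, and for every absolutely continuous curve $\mu:[0,1]\to U$ and almost every $t$, $\frac{d}{dt}G(\mu(t))=V\dot\mu(t)$ for all $V\in J_G(\mu(t))$. $G$ is path-differentiable if it has a conservative Jacobian. Regularity assumption: for every $\theta\in\Theta$, $f(\cdot,\theta)$ is $\mathcal{C}^{1,1}(\mathbb{R}^n)$ (differentiable with Lipschitz gradient), convex, and $\mathcal{S}(\theta):=\operatorname{argmin}_xf(x,\theta)\ne\emptyset$; and $F:=\nabla_xf$ is locally Lipschitz jointly in $(x,\theta)$. Definability assumption: $f$ and $\Theta$ are definable. $x^\star_{\min}(\theta)$ is the minimal Euclidean norm element of $\mathcal{S}(\theta)$; for $\varepsilon>0$, $x^\star_\varepsilon(\theta)$ is the unique minimizer of $x\mapsto f(x,\theta)+\frac{\varepsilon}{2}\|x\|_2^2$. Elements of a conservative Jacobian $J_F(x,\theta)$ are written blockwise as $(H\ M)$ with $H\in\mathbb{R}^{n\times n}$ ($x$-block), $M\in\mathbb{R}^{n\times m}$ ($\theta$-block). Uniform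 range condition (on $O$ open and definable, with $\bar\varepsilon>0$ fixed and $J_F$ a definable conservative Jacobian of $F$): for every compact $K\subset O$ there exists $C_K>0$ such that, for every $\theta\in K$, $0<\varepsilon\le\bar\varepsilon$ and $(H_\varepsilon\ M_\varepsilon)\in J_F(x^\star_\varepsilon(\theta),\theta)$, the block $H_\varepsilon$ is symmetric positive semidefinite and $M_\varepsilon=H_\varepsilon W_\varepsilon$ for some $W_\varepsilon\in\mathbb{R}^{n\times m}$ with $\|W_\varepsilon\|\le C_K$. *)

theory Defs
  imports "HOL-Analysis.Analysis"
begin

section \<open>O-minimal structures expanding the real field\<close>

text \<open>Subsets of the n-th Cartesian power of the reals are represented as sets of real lists of
  length n, so that one structure can speak about all dimensions at once.\<close>

inductive polynomial_map :: "nat \<Rightarrow> (real list \<Rightarrow> real) \<Rightarrow> bool" for n where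
  const: "polynomial_map n (\<lambda>_. c)"
| coord: "i < n \<Longrightarrow> polynomial_map n (\<lambda>xs. xs ! i)"
| add: "polynomial_map n p \<Longrightarrow> polynomial_map n q \<Longrightarrow> polynomial_map n (\<lambda>xs. p xs + q xs)"
| mult: "polynomial_map n p \<Longrightarrow> polynomial_map n q \<Longrightarrow> polynomial_map n (\<lambda>xs. p xs * q xs)"

text \<open>In the last axiom, \<open>is_interval\<close> covers points, bounded and unbounded intervals.\<close>

locale o_minimal_structure =
  fixes S :: "nat \<Rightarrow> real list set set"
  assumes dimension: "A \<in> S n \<Longrightarrow> A \<subseteq> {xs. length xs = n}"
    and union: "A \<in> S n \<Longrightarrow> B \<in> S n \<Longrightarrow> A \<union> B \<in> S n"
    and complement: "A \<in> S n \<Longrightarrow> {xs. length xs = n} - A \<in> S n"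
    and product_left: "A \<in> S n \<Longrightarrow> {y # xs | y xs. xs \<in> A} \<in> S (Suc n)"
    and product_right: "A \<in> S n \<Longrightarrow> {xs @ [y] | xs y. xs \<in> A} \<in> S (Suc n)"
    and projection: "A \<in> S (Suc n) \<Longrightarrow> butlast ` A \<in> S n"
    and algebraic: "polynomial_map n p \<Longrightarrow> {xs. length xs = n \<and> p xs = 0} \<in> S n"
    and o_minimal: "S 1 = {(\<lambda>x. [x]) ` \<Union>\<I> | \<I>. finite \<I> \<and> (\<forall>I\<in>\<I>. is_interval I)}"

text \<open>The structure is closed under permutations of the coordinates, so the choice of the
  enumeration \<open>bs\<close> of the coordinate axes is immaterial.\<close>

definition definable :: "(nat \<Rightarrow> real list set set) \<Rightarrow> 'a::euclidean_space set \<Rightarrow> bool" where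
  "definable S A \<longleftrightarrow>
     (\<exists>bs. distinct bs \<and> set bs = Basis \<and> (\<lambda>x. map (\<lambda>b. x \<bullet> b) bs) ` A \<in> S DIM('a))"

section \<open>Conservative Jacobians\<close>

definition locally_lipschitz_on :: "'a::metric_space set \<Rightarrow> ('a \<Rightarrow> 'b::metric_space) \<Rightarrow> bool" where
  "locally_lipschitz_on U G \<longleftrightarrow> (\<forall>x\<in>U. \<exists>r>0. \<exists>L. L-lipschitz_on (ball x r \<inter> U) G)"

definition absolutely_continuous_curve :: "(real \<Rightarrow> 'a::real_normed_vector) \<Rightarrow> bool" where
  "absolutely_continuous_curve \<mu> \<longleftrightarrow>
     (\<forall>e>0. \<exists>d>0. \<forall>\<D>. \<D> division_of \<Union>\<D> \<and> \<Union>\<D> \<subseteq> {0..1} \<and> (\<Sum>I\<in>\<D>. Sup I - Inf I) < d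
        \<longrightarrow> (\<Sum>I\<in>\<D>. norm (\<mu> (Sup I) - \<mu> (Inf I))) < e)"

text \<open>An absolutely continuous curve is differentiable almost everywhere, so the existence of
  the velocity \<open>v\<close> below is no additional requirement.\<close>

definition conservative_jacobian ::
    "(real^'d) set \<Rightarrow> (real^'d \<Rightarrow> real^'q) \<Rightarrow> (real^'d \<Rightarrow> (real^'d^'q) set) \<Rightarrow> bool" where
  "conservative_jacobian U G J \<longleftrightarrow>
     open U \<and> locally_lipschitz_on U G \<and>
     (\<forall>x\<in>U. J x \<noteq> {}) \<and>
     (\<forall>x\<in>U. \<exists>r>0. bounded (\<Union>y\<in>ball x r \<inter> U. J y)) \<and>
     closedin (top_of_set (U \<times> UNIV)) {(x, V). x \<in> U \<and> V \<in> J x} \<and>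
     (\<forall>\<mu>. absolutely_continuous_curve \<mu> \<and> \<mu> ` {0..1} \<subseteq> U \<longrightarrow>
        (AE t in lebesgue_on {0..1}.
           \<exists>v. (\<mu> has_vector_derivative v) (at t within {0..1}) \<and>
               (\<forall>V\<in>J (\<mu> t).
                  ((\<lambda>s. G (\<mu> s)) has_vector_derivative V *v v) (at t within {0..1}))))"

section \<open>The parametric problem\<close>

definition gradient :: "('a::real_inner \<Rightarrow> real) \<Rightarrow> 'a \<Rightarrow> 'a" where
  "gradient g x = (THE D. GDERIV g x :> D)"

definition argmin_set :: "('a \<Rightarrow> real) \<Rightarrow> 'a set" where
  "argmin_set g = {x. is_arg_min g (\<lambda>_. True) x}"

text \<open>A pair of a point x and a parameter is a single vector z indexed by the sum type;
  \<open>x_part\<close> and \<open>\<theta>_part\<close> recover the two components, \<open>x_block\<close> and \<open>\<theta>_block\<close>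
  the blocks H and M of a matrix (H M).\<close>

definition joint :: "real^'n \<Rightarrow> real^'m \<Rightarrow> real^('n::finite + 'm::finite)" where
  "joint x \<theta> = (\<chi> k. case k of Inl i \<Rightarrow> x $ i | Inr j \<Rightarrow> \<theta> $ j)"

definition x_part :: "real^('n::finite + 'm::finite) \<Rightarrow> real^'n" where
  "x_part z = (\<chi> i. z $ Inl i)"

definition \<theta>_part :: "real^('n::finite + 'm::finite) \<Rightarrow> real^'m" where
  "\<theta>_part z = (\<chi> j. z $ Inr j)"

definition x_block :: "real^('n::finite + 'm::finite)^'q \<Rightarrow> real^'n^'q" where
  "x_block V = (\<chi> i. x_part (V $ i))"

definition \<theta>_block :: "real^('n::finite + 'm::finite)^'q \<Rightarrow> real^'m^'q" where
  "\<theta>_block V = (\<chi> i. \<theta>_part (V $ i))"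

definition grad_x :: "(real^'n \<Rightarrow> real^'m \<Rightarrow> real) \<Rightarrow> real^('n::finite + 'm::finite) \<Rightarrow> real^'n" where
  "grad_x f z = gradient (\<lambda>x. f x (\<theta>_part z)) (x_part z)"

definition regularity :: "(real^'n \<Rightarrow> real^'m \<Rightarrow> real) \<Rightarrow> (real^'m) set \<Rightarrow> bool" where
  "regularity f \<Theta> \<longleftrightarrow>
     (\<forall>\<theta>\<in>\<Theta>. (\<forall>x. (\<lambda>x. f x \<theta>) differentiable (at x)) \<and>
            (\<exists>L. L-lipschitz_on UNIV (gradient (\<lambda>x. f x \<theta>))) \<and>
            convex_on UNIV (\<lambda>x. f x \<theta>) \<and>
            argmin_set (\<lambda>x. f x \<theta>) \<noteq> {}) \<and>
     locally_lipschitz_on {z. \<theta>_part z \<in> \<Theta>} (grad_x f)"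

definition x_min :: "(real^'n \<Rightarrow> real^'m \<Rightarrow> real) \<Rightarrow> real^'m \<Rightarrow> real^'n" where
  "x_min f \<theta> = (THE x. is_arg_min norm (\<lambda>y. y \<in> argmin_set (\<lambda>u. f u \<theta>)) x)"

definition x_reg :: "(real^'n \<Rightarrow> real^'m \<Rightarrow> real) \<Rightarrow> real \<Rightarrow> real^'m \<Rightarrow> real^'n" where
  "x_reg f \<epsilon> \<theta> = (THE x. x \<in> argmin_set (\<lambda>u. f u \<theta> + \<epsilon> / 2 * (norm u)\<^sup>2))"

definition x_star :: "(real^'n \<Rightarrow> real^'m \<Rightarrow> real) \<Rightarrow> (real^'m) \<times> real \<Rightarrow> real^'n" where
  "x_star f = (\<lambda>(\<theta>, \<epsilon>). if \<epsilon> > 0 then x_reg f \<epsilon> \<theta> else x_min f \<theta>)"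

definition op_norm :: "real^'n^'q \<Rightarrow> real" where
  "op_norm A = onorm ((*v) A)"

definition uniform_range_condition ::
    "(real^'n \<Rightarrow> real^'m \<Rightarrow> real) \<Rightarrow> (real^'m) set \<Rightarrow> real \<Rightarrow>
     (real^('n::finite + 'm::finite) \<Rightarrow> (real^('n::finite + 'm::finite)^'n) set) \<Rightarrow> bool" where
  "uniform_range_condition f U \<epsilon>bar J\<^sub>F \<longleftrightarrow>
     (\<forall>K. compact K \<and> K \<subseteq> U \<longrightarrow>
        (\<exists>C>0. \<forall>\<theta>\<in>K. \<forall>\<epsilon>. 0 < \<epsilon> \<and> \<epsilon> \<le> \<epsilon>bar \<longrightarrow>
           (\<forall>V\<in>J\<^sub>F (joint (x_reg f \<epsilon> \<theta>) \<theta>).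
              transpose (x_block V) = x_block V \<and>
              (\<forall>v. 0 \<le> v \<bullet> (x_block V *v v)) \<and>
              (\<exists>W. \<theta>_block V = x_block V ** W \<and> op_norm W \<le> C))))"

definition jacobian_bound ::
    "(real \<Rightarrow> real^'m \<Rightarrow> (real^'m^'n) set) \<Rightarrow> (real^'m) set \<Rightarrow> real \<Rightarrow> real \<Rightarrow> bool" where
  "jacobian_bound J K \<epsilon>\<^sub>K C \<longleftrightarrow>
     (\<forall>\<theta>\<in>K. \<forall>\<epsilon>. 0 < \<epsilon> \<and> \<epsilon> \<le> \<epsilon>\<^sub>K \<longrightarrow> (\<forall>V\<in>J \<epsilon> \<theta>. op_norm V \<le> C))"

definition stable_selection :: "(real^'n \<Rightarrow> real^'m \<Rightarrow> real) \<Rightarrow> (real^'m) set \<Rightarrow> bool" where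
  "stable_selection f U \<longleftrightarrow>
     locally_lipschitz_on U (x_min f) \<and>
     continuous_on (U \<times> {0..}) (x_star f) \<and>
     (\<forall>K. compact K \<and> K \<subseteq> U \<longrightarrow> uniform_limit K (x_reg f) (x_min f) (at_right 0))"

end

theory Submission
  imports Defs
begin

text \<open>On a segment in \<open>U\<close> the curve \<open>t \<mapsto> x_reg f \<epsilon> (\<mu> t)\<close> is Lipschitz, and the chain rule for the
  conservative Jacobian bounds its derivative almost everywhere by a constant that does not depend
  on \<open>\<epsilon>\<close>; hence the maps \<open>x_reg f \<epsilon>\<close> are uniformly Lipschitz on convex compact sets. Under the
  range condition no implicit function theorem is needed: differentiating
  \<open>F(x(t), \<mu> t) + \<epsilon> x(t) = 0\<close> along the curve gives \<open>H x' + \<epsilon> x' + H W \<mu>' = 0\<close>, and pairing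
  with \<open>x' + W \<mu>'\<close> yields \<open>|x'| \<le> |W \<mu>'|\<close>. Uniform Lipschitz bounds together with
  the pointwise Tikhonov convergence \<open>x_reg f \<epsilon> \<theta> \<rightarrow> x_min f \<theta>\<close> give all three stability claims.\<close>

section \<open>Lipschitz maps and conservative Jacobians\<close>

text \<open>A mean value inequality that tolerates a null set of bad points. The increment is
  telescoped over a fine tagged division: intervals tagged at good points grow at slope at most
  \<open>C\<close> plus a slack, and intervals tagged at bad points are controlled by the Lipschitz
  constant times a small total length.\<close>

lemma norm_diff_le_of_AE_derivative_bound:
  fixes g :: "real \<Rightarrow> 'a::real_normed_vector"
  assumes "C \<ge> 0" and lip: "L-lipschitz_on {0..1} g"
    and der: "AE t in lebesgue_on {0..1}. \<exists>v. (g has_vector_derivative v) (at t within {0..1}) \<and> norm v \<le> C"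
  shows "norm (g 1 - g 0) \<le> C"
proof -
  define good where "good t \<longleftrightarrow> (\<exists>v. (g has_vector_derivative v) (at t within {0..1}) \<and> norm v \<le> C)" for t
  define N where "N = {t \<in> {0..1}. \<not> good t}"
  have "AE t in lebesgue. t \<in> {0..1} \<longrightarrow> good t"
    using der unfolding good_def by (subst (asm) AE_restrict_space_iff) auto
  then obtain Z where Z: "Z \<in> null_sets lebesgue" "{t. \<not> (t \<in> {0..1} \<longrightarrow> good t)} \<subseteq> Z"
    by (auto simp: eventually_ae_filter)
  have "negligible Z"
    using Z(1) by (simp add: negligible_iff_null_sets)
  moreover have "N \<subseteq> Z"
    using Z(2) by (auto simp: N_def)
  ultimately have "negligible N"
    by (rule negligible_subset)
  \<comment> \<open>A null integral yields a gauge for which the intervals tagged in \<open>N\<close> have small total length;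
    on these the Lipschitz bound suffices.\<close>
  then have N0: "((indicator N :: real \<Rightarrow> real) has_integral 0) {0..1}"
    by (metis negligible_def box_real(2))
  have L0: "L \<ge> 0"
    using lip by (rule lipschitz_on_nonneg)
  \<comment> \<open>The error splits into \<open>e\<close> from the slack in the slope over total
    length 1 and \<open>L * e\<close> from the intervals tagged in \<open>N\<close>.\<close>
  have bound: "norm (g 1 - g 0) \<le> C + e * (1 + L)" if "e > 0" for e
  proof -
    from N0 \<open>e > 0\<close> obtain \<gamma> where \<gamma>: "gauge \<gamma>"
      "\<And>\<D>. \<D> tagged_division_of {0..1} \<Longrightarrow> \<gamma> fine \<D> \<Longrightarrow>
        norm ((\<Sum>(x,K)\<in>\<D>. measure lborel K *\<^sub>R (indicator N x :: real)) - 0) < e"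
      unfolding has_integral_real by metis
    have "\<exists>d>0. \<forall>s\<in>{0..1}. \<bar>s - t\<bar> < d \<longrightarrow> norm (g s - g t) \<le> (C + e) * \<bar>s - t\<bar>"
      if "good t" for t
    proof -
      from that obtain v where v: "(g has_vector_derivative v) (at t within {0..1})" "norm v \<le> C"
        unfolding good_def by blast
      then obtain d where "d > 0" and d: "\<And>s. s \<in> {0..1} \<Longrightarrow> \<bar>s - t\<bar> < d \<Longrightarrow>
          norm (g s - g t - (s - t) *\<^sub>R v) \<le> e * \<bar>s - t\<bar>"
        using \<open>e > 0\<close> unfolding has_vector_derivative_def has_derivative_within_alt real_norm_def
        by metis
      have "norm (g s - g t) \<le> (C + e) * \<bar>s - t\<bar>" if s: "s \<in> {0..1}" "\<bar>s - t\<bar> < d" for s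
      proof -
        have "norm (g s - g t) \<le> norm (g s - g t - (s - t) *\<^sub>R v) + norm ((s - t) *\<^sub>R v)"
          by (metis diff_add_cancel norm_triangle_ineq)
        also have "\<dots> \<le> e * \<bar>s - t\<bar> + \<bar>s - t\<bar> * C"
          using d[OF s] v(2) by (simp add: add_mono mult_left_mono)
        finally show ?thesis by (simp add: algebra_simps)
      qed
      with \<open>d > 0\<close> show ?thesis by blast
    qed
    then obtain d where d: "\<And>t. good t \<Longrightarrow> d t > 0"
      "\<And>t s. good t \<Longrightarrow> s \<in> {0..1} \<Longrightarrow> \<bar>s - t\<bar> < d t \<Longrightarrow> norm (g s - g t) \<le> (C + e) * \<bar>s - t\<bar>"
      by metis
    \<comment> \<open>At bad points no smallness is imposed: there the global Lipschitz bound is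
      used instead of differentiability.\<close>
    define \<beta> where "\<beta> t = (if good t then ball t (d t) else UNIV)" for t
    have "gauge (\<lambda>t. \<gamma> t \<inter> \<beta> t)"
      using \<gamma>(1) d(1) by (intro gauge_Int) (auto simp: gauge_def \<beta>_def)
    then obtain p where p: "p tagged_division_of {0..1}" "(\<lambda>t. \<gamma> t \<inter> \<beta> t) fine p"
      by (rule fine_division_exists_real)
    then have fine: "\<gamma> fine p" "\<beta> fine p"
      by (auto simp: fine_Int)
    have "norm (g 1 - g 0) = norm (\<Sum>(x,K)\<in>p. g (Sup K) - g (Inf K))"
      using additive_tagged_division_1[OF _ p(1), of g] by simp
    \<comment> \<open>The second summand vanishes for tags outside \<open>N\<close>; for tags in
      \<open>N\<close> the first one is merely a nonnegative surplus.\<close>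
    also have "\<dots> \<le> (\<Sum>(x,K)\<in>p. (C + e) * measure lborel K + L * (measure lborel K *\<^sub>R indicator N x))"
    proof (rule sum_norm_le, safe)
      fix x K assume xK: "(x, K) \<in> p"
      then obtain a b where ab: "K = {a..b}" "x \<in> {a..b}" "{a..b} \<subseteq> {0..1}"
        using tagged_division_ofD(2-4)[OF p(1) xK] by (metis box_real(2))
      then have le: "a \<le> x" "x \<le> b" "a \<in> {0..1}" "b \<in> {0..1}" "x \<in> {0..1}"
        by auto
      show "norm (g (Sup K) - g (Inf K)) \<le> (C + e) * measure lborel K + L * (measure lborel K *\<^sub>R indicator N x)"
      proof (cases "x \<in> N")
        case True
        have "0 \<le> C + e"
          using \<open>C \<ge> 0\<close> \<open>e > 0\<close> by simp
        moreover have "norm (g b - g a) \<le> L * (b - a)"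
          using lipschitz_on_normD[OF lip, of b a] le by simp
        ultimately show ?thesis
          using True ab le by (simp add: add_increasing)
      next
        case False
        then have "good x"
          using le by (auto simp: N_def)
        then have "{a..b} \<subseteq> ball x (d x)"
          using fineD[OF fine(2) xK] ab(1) by (simp add: \<beta>_def)
        then have "a \<in> ball x (d x)" "b \<in> ball x (d x)"
          using le atLeastAtMost_iff order_refl by (blast intro: order_trans)+
        then have "norm (g a - g x) \<le> (C + e) * \<bar>a - x\<bar>" "norm (g b - g x) \<le> (C + e) * \<bar>b - x\<bar>"
          using d(2)[OF \<open>good x\<close> le(3)] d(2)[OF \<open>good x\<close> le(4)]
          by (simp_all add: dist_real_def abs_minus_commute)
        \<comment> \<open>The tag lies between the endpoints, so its distances to them add up to the
          length of the interval.\<close>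
        then have "norm (g b - g a) \<le> (C + e) * \<bar>b - x\<bar> + (C + e) * \<bar>a - x\<bar>"
          using norm_triangle_ineq4[of "g b - g x" "g a - g x"] by simp
        then show ?thesis
          using False ab(1) le by (simp add: algebra_simps)
      qed
    qed
    also have "\<dots> = (C + e) * (\<Sum>(x,K)\<in>p. measure lborel K) + L * (\<Sum>(x,K)\<in>p. measure lborel K *\<^sub>R indicator N x)"
      by (simp add: sum.distrib sum_distrib_left split_def)
    also have "(\<Sum>(x,K)\<in>p. measure lborel K) = 1"
      using additive_content_tagged_division[of p 0 "1::real"] p(1) by simp
    also have "L * (\<Sum>(x,K)\<in>p. measure lborel K *\<^sub>R indicator N x) \<le> L * e"
      using \<gamma>(2)[OF p(1) fine(1)] L0 by (intro mult_left_mono) simp_all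
    finally show ?thesis
      by (simp add: algebra_simps)
  qed
  show ?thesis
  proof (rule field_le_epsilon)
    fix e :: real assume "e > 0"
    then have "norm (g 1 - g 0) \<le> C + e / (1 + L) * (1 + L)"
      using L0 by (intro bound) simp
    then show "norm (g 1 - g 0) \<le> C + e"
      using L0 by simp
  qed
qed

text \<open>\<open>local_lipschitz\<close> speaks about time-dependent maps; the singleton time set
  \<open>{0}\<close> makes its compactness theorem available for \<open>G\<close>.\<close>

lemma locally_lipschitz_on_compact:
  assumes "locally_lipschitz_on U G" "compact K" "K \<subseteq> U"
  obtains L where "L-lipschitz_on K G"
proof -
  have "local_lipschitz {0::real} K (\<lambda>_. G)"
    unfolding local_lipschitz_def
  proof (intro ballI)
    fix x and t :: real assume "x \<in> K"
    then obtain r L where "r > 0" "L-lipschitz_on (ball x r \<inter> U) G"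
      using assms unfolding locally_lipschitz_on_def by blast
    \<comment> \<open>Halving the radius fits the closed ball inside the open one.\<close>
    then have "L-lipschitz_on (cball x (r/2) \<inter> K) G"
      using \<open>K \<subseteq> U\<close> by (auto elim!: lipschitz_on_subset)
    then show "\<exists>u>0. \<exists>L. \<forall>t\<in>cball t u \<inter> {0}. L-lipschitz_on (cball x u \<inter> K) G"
      using \<open>r > 0\<close> by (intro exI[of _ "r/2"]) auto
  qed
  then show ?thesis
    using local_lipschitz_compact_implies_lipschitz[where X = K and T = "{0::real}" and f = "\<lambda>_. G"]
      that \<open>compact K\<close> by auto
qed

lemma locally_lipschitz_on_imp_continuous_on:
  assumes "locally_lipschitz_on U G"
  shows "continuous_on U G"
  unfolding continuous_on_eq_continuous_within
proof
  fix x assume "x \<in> U"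
  then obtain r L where "r > 0" "L-lipschitz_on (ball x r \<inter> U) G"
    using assms unfolding locally_lipschitz_on_def by blast
  then have "continuous (at x within ball x r \<inter> U) G"
    using \<open>x \<in> U\<close> by (intro lipschitz_on_continuous_within) auto
  moreover have "at x within ball x r \<inter> U = at x within U"
    using \<open>r > 0\<close> by (intro at_within_nhd[of x "ball x r"]) auto
  ultimately show "continuous (at x within U) G"
    by simp
qed

section \<open>Segments as test curves\<close>

lemma lipschitz_on_absolutely_continuous_curve:
  fixes \<mu> :: "real \<Rightarrow> 'a::real_normed_vector"
  assumes lip: "L-lipschitz_on {0..1} \<mu>"
  shows "absolutely_continuous_curve \<mu>"
  unfolding absolutely_continuous_curve_def
proof (intro allI impI)
  fix e :: real assume "e > 0"
  have L0: "L \<ge> 0"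
    using lip by (rule lipschitz_on_nonneg)
  show "\<exists>d>0. \<forall>\<D>. \<D> division_of \<Union>\<D> \<and> \<Union>\<D> \<subseteq> {0..1} \<and> (\<Sum>I\<in>\<D>. Sup I - Inf I) < d
        \<longrightarrow> (\<Sum>I\<in>\<D>. norm (\<mu> (Sup I) - \<mu> (Inf I))) < e"
  proof (intro exI conjI allI impI)
    \<comment> \<open>The summand 1 keeps the quotient positive when \<open>L\<close> is 0.\<close>
    show "0 < e / (L + 1)" using \<open>e > 0\<close> L0 by simp
    fix \<D> :: "real set set"
    assume \<D>: "\<D> division_of \<Union>\<D> \<and> \<Union>\<D> \<subseteq> {0..1} \<and> (\<Sum>I\<in>\<D>. Sup I - Inf I) < e / (L + 1)"
    have I: "Inf I \<in> {0..1} \<and> Sup I \<in> {0..1} \<and> Inf I \<le> Sup I" if mem: "I \<in> \<D>" for I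
    proof -
      have div: "\<D> division_of \<Union>\<D>" and sub: "I \<subseteq> {0..1}"
        using \<D> mem by auto
      obtain a b where ab: "I = {a..b}"
        using division_ofD(4)[OF div mem] by auto
      have "I \<noteq> {}"
        by (rule division_ofD(3)[OF div mem])
      with ab sub have "a \<le> b" "a \<in> {0..1}" "b \<in> {0..1}"
        by auto
      with ab show ?thesis by simp
    qed
    have "(\<Sum>I\<in>\<D>. norm (\<mu> (Sup I) - \<mu> (Inf I))) \<le> (\<Sum>I\<in>\<D>. L * (Sup I - Inf I))"
    proof (rule sum_mono)
      fix I assume "I \<in> \<D>"
      then show "norm (\<mu> (Sup I) - \<mu> (Inf I)) \<le> L * (Sup I - Inf I)"
        using lipschitz_on_normD[OF lip, of "Sup I" "Inf I"] I by simp
    qed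
    also have "\<dots> \<le> (L + 1) * (\<Sum>I\<in>\<D>. Sup I - Inf I)"
      using I by (auto simp: sum_distrib_left algebra_simps intro!: sum_mono)
    also have "\<dots> < e"
      using \<D> L0 by (simp add: field_simps)
    finally show "(\<Sum>I\<in>\<D>. norm (\<mu> (Sup I) - \<mu> (Inf I))) < e" .
  qed
qed

lemma segment_lipschitz:
  fixes a b :: "'a::real_normed_vector"
  shows "(norm (b - a))-lipschitz_on T (\<lambda>t. a + t *\<^sub>R (b - a))"
  by (rule lipschitz_onI) (simp_all add: dist_norm norm_minus_commute flip: scaleR_diff_left)

text \<open>Convexity keeps segments in \<open>K\<close>, which reduces the claim to one dimension.
  Local Lipschitz continuity enters only qualitatively, making the composition with a segment
  Lipschitz with some constant; the final constant is the bound \<open>C\<close> on the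
  derivatives.\<close>

lemma lipschitz_on_of_AE_derivative_bound:
  fixes G :: "'a::euclidean_space \<Rightarrow> 'b::real_normed_vector"
  assumes K: "convex K" "compact K" "K \<subseteq> U" and lip: "locally_lipschitz_on U G" and "C \<ge> 0"
    and der: "\<And>a b. a \<in> K \<Longrightarrow> b \<in> K \<Longrightarrow> AE t in lebesgue_on {0..1}. \<exists>w.
      ((\<lambda>t. G (a + t *\<^sub>R (b - a))) has_vector_derivative w) (at t within {0..1}) \<and>
      norm w \<le> C * norm (b - a)"
  shows "C-lipschitz_on K G"
proof (rule lipschitz_onI)
  fix a b assume ab: "a \<in> K" "b \<in> K"
  obtain L where L: "L-lipschitz_on K G"
    using locally_lipschitz_on_compact[OF lip K(2,3)] .
  let ?\<mu> = "\<lambda>t. a + t *\<^sub>R (b - a)"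
  have "(norm (b - a))-lipschitz_on {0..1} ?\<mu>"
    by (rule segment_lipschitz)
  moreover have "?\<mu> ` {0..1} \<subseteq> K"
    using convexD_alt[OF K(1) ab] by (auto simp: algebra_simps)
  ultimately have "(L * norm (b - a))-lipschitz_on {0..1} (\<lambda>t. G (?\<mu> t))"
    using L by (intro lipschitz_on_compose2) (auto intro: lipschitz_on_subset)
  then have "norm (G (?\<mu> 1) - G (?\<mu> 0)) \<le> C * norm (b - a)"
    using der[OF ab] \<open>C \<ge> 0\<close> by (intro norm_diff_le_of_AE_derivative_bound) simp_all
  then show "dist (G a) (G b) \<le> C * dist a b"
    by (simp add: dist_norm norm_minus_commute)
qed (rule \<open>C \<ge> 0\<close>)

lemma norm_mult_le_op_norm: "norm (A *v v) \<le> op_norm A * norm v"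
  unfolding op_norm_def by (rule onorm) (rule matrix_vector_mul_bounded_linear)

text \<open>A segment has constant velocity \<open>b - a\<close>, so the chain rule gives the
  derivative \<open>V *v (b - a)\<close> for almost every \<open>t\<close>, and its norm is at most
  \<open>C * norm (b - a)\<close>.\<close>

lemma conservative_jacobian_imp_lipschitz:
  fixes G :: "real^'m \<Rightarrow> real^'n"
  assumes G: "conservative_jacobian U G J" and K: "convex K" "compact K" "K \<subseteq> U"
    and "C \<ge> 0" and bound: "\<And>\<theta> V. \<theta> \<in> K \<Longrightarrow> V \<in> J \<theta> \<Longrightarrow> op_norm V \<le> C"
  shows "C-lipschitz_on K G"
proof (rule lipschitz_on_of_AE_derivative_bound[OF K _ \<open>C \<ge> 0\<close>])
  show "locally_lipschitz_on U G"
    using G by (simp add: conservative_jacobian_def)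
  fix a b assume ab: "a \<in> K" "b \<in> K"
  let ?\<mu> = "\<lambda>t. a + t *\<^sub>R (b - a)"
  have in_K: "?\<mu> t \<in> K" if "t \<in> {0..1}" for t
    using convexD_alt[OF K(1) ab, of t] that by (simp add: algebra_simps)
  have "absolutely_continuous_curve ?\<mu>"
    using lipschitz_on_absolutely_continuous_curve segment_lipschitz by blast
  then have "AE t in lebesgue_on {0..1}.
           \<exists>v. (?\<mu> has_vector_derivative v) (at t within {0..1}) \<and>
               (\<forall>V\<in>J (?\<mu> t).
                  ((\<lambda>s. G (?\<mu> s)) has_vector_derivative V *v v) (at t within {0..1}))"
    using G in_K K(3) unfolding conservative_jacobian_def by blast
  with AE_space show "AE t in lebesgue_on {0..1}. \<exists>w.
      ((\<lambda>t. G (?\<mu> t)) has_vector_derivative w) (at t within {0..1}) \<and> norm w \<le> C * norm (b - a)"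
  proof eventually_elim
    case (elim t)
    then have t: "t \<in> {0..1}" by simp
    from elim obtain v where v: "(?\<mu> has_vector_derivative v) (at t within {0..1})"
      "\<And>V. V \<in> J (?\<mu> t) \<Longrightarrow> ((\<lambda>s. G (?\<mu> s)) has_vector_derivative V *v v) (at t within {0..1})"
      by blast
    \<comment> \<open>The chain rule supplies an unspecified velocity \<open>v\<close>; uniqueness
      of derivatives on a nondegenerate interval identifies it.\<close>
    have "(?\<mu> has_vector_derivative (b - a)) (at t within {0..1})"
      by (auto intro!: derivative_eq_intros)
    then have "v = b - a"
      using v(1) t by (intro vector_derivative_unique_within[OF _ v(1)]) (auto simp: trivial_limit_within islimpt_Icc)
    obtain V where V: "V \<in> J (?\<mu> t)"
      using G in_K[OF t] K(3) unfolding conservative_jacobian_def by blast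
    have "norm (V *v v) \<le> C * norm (b - a)"
      using norm_mult_le_op_norm[of V v] bound[OF in_K[OF t] V] \<open>v = b - a\<close>
      by (meson mult_right_mono norm_ge_zero order_trans)
    then show ?case
      using v(2)[OF V] by blast
  qed
qed

section \<open>Regularized convex minimization\<close>

text \<open>The gradient is the Riesz representative of the derivative, obtained as the adjoint at
  1. Uniqueness is proved as well, since \<open>gradient\<close> is a definite description.\<close>

lemma differentiable_imp_GDERIV_gradient:
  fixes g :: "'a::euclidean_space \<Rightarrow> real"
  assumes "g differentiable (at x)"
  shows "GDERIV g x :> gradient g x"
proof -
  obtain g' where g': "(g has_derivative g') (at x)"
    using assms by (auto simp: differentiable_def)
  have "g' = (\<lambda>h. h \<bullet> adjoint g' 1)"
    using adjoint_works[OF has_derivative_linear[OF g'], of _ 1] by auto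
  with g' have "GDERIV g x :> adjoint g' 1"
    unfolding gderiv_def by metis
  moreover have "D = adjoint g' 1" if "GDERIV g x :> D" for D
  proof -
    have "(\<lambda>h. h \<bullet> D) = g'"
      using that g' unfolding gderiv_def by (rule has_derivative_unique)
    then have "h \<bullet> (D - adjoint g' 1) = 0" for h
      using \<open>g' = _\<close> by (metis inner_diff_right right_minus_eq)
    then show ?thesis
      by (metis inner_eq_zero_iff right_minus_eq)
  qed
  ultimately show ?thesis
    unfolding gradient_def by (metis theI)
qed

text \<open>Restriction to the line through \<open>x\<close> and \<open>y\<close> reduces this to
  the tangent inequality for convex functions of one real variable.\<close>

lemma convex_on_imp_above_gradient:
  fixes g :: "'a::euclidean_space \<Rightarrow> real"
  assumes "convex_on UNIV g" "g differentiable (at x)"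
  shows "g x + gradient g x \<bullet> (y - x) \<le> g y"
proof -
  let ?l = "\<lambda>t::real. x + t *\<^sub>R (y - x)"
  have "convex_on UNIV (\<lambda>t. g (?l t))"
  proof (rule convex_onI)
    fix t a b :: real assume t: "0 < t" "t < 1"
    have "?l ((1 - t) *\<^sub>R a + t *\<^sub>R b) = (1 - t) *\<^sub>R ?l a + t *\<^sub>R ?l b"
      by (simp add: algebra_simps)
    then show "g (?l ((1 - t) *\<^sub>R a + t *\<^sub>R b)) \<le> (1 - t) * g (?l a) + t * g (?l b)"
      using convex_onD[OF assms(1), of t "?l a" "?l b"] t by simp
  qed simp
  moreover have "((\<lambda>t. g (?l t)) has_field_derivative gradient g x \<bullet> (y - x)) (at 0)"
  proof -
    have "(g has_derivative (\<lambda>h. h \<bullet> gradient g x)) (at (?l 0))"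
      using differentiable_imp_GDERIV_gradient[OF assms(2)] by (simp add: gderiv_def)
    moreover have "(?l has_derivative (\<lambda>t. t *\<^sub>R (y - x))) (at 0)"
      by (auto intro!: derivative_eq_intros)
    ultimately have "((\<lambda>t. g (?l t)) has_derivative (\<lambda>t. (t *\<^sub>R (y - x)) \<bullet> gradient g x)) (at 0)"
      by (rule has_derivative_compose[rotated])
    then show ?thesis
      by (simp add: has_field_derivative_def inner_commute mult_commute_abs)
  qed
  ultimately have "g (?l 1) - g (?l 0) \<ge> (gradient g x \<bullet> (y - x)) * (1 - 0)"
    by (intro convex_on_imp_above_tangent[of UNIV]) simp_all
  then show ?thesis by simp
qed

lemma mem_argmin_set_iff: "x \<in> argmin_set g \<longleftrightarrow> (\<forall>y. g x \<le> g y)"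
  for g :: "'a \<Rightarrow> real"
  by (auto simp: argmin_set_def is_arg_min_linorder)

text \<open>The set of minimizers is an intersection of sublevel sets.\<close>

lemma argmin_set_closed_convex:
  fixes g :: "'a::euclidean_space \<Rightarrow> real"
  assumes "continuous_on UNIV g" "convex_on UNIV g"
  shows "closed (argmin_set g)" "convex (argmin_set g)"
proof -
  have eq: "argmin_set g = (\<Inter>y. {x. g x \<le> g y})"
    by (auto simp: mem_argmin_set_iff)
  show "closed (argmin_set g)"
    unfolding eq using assms(1) by (intro closed_INT ballI closed_Collect_le continuous_on_const)
  have "convex {x. g x \<le> g y}" for y
    unfolding convex_alt
  proof (intro ballI allI impI)
    fix u v and t :: real
    assume uv: "u \<in> {x. g x \<le> g y}" "v \<in> {x. g x \<le> g y}" and t: "0 \<le> t \<and> t \<le> 1"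
    have "g ((1 - t) *\<^sub>R u + t *\<^sub>R v) \<le> (1 - t) * g u + t * g v"
      using t by (intro convex_onD[OF assms(2)]) auto
    also have "\<dots> \<le> g y"
      using uv t by (intro convex_bound_le) auto
    finally show "(1 - t) *\<^sub>R u + t *\<^sub>R v \<in> {x. g x \<le> g y}" by simp
  qed
  then show "convex (argmin_set g)"
    unfolding eq by (intro convex_INT) simp
qed

text \<open>For a minimizer \<open>p\<close> of \<open>g\<close>, both summands are at least as
  large outside the ball of radius \<open>norm p\<close> as they are at \<open>p\<close>. A minimum
  over this compact ball is therefore global.\<close>

lemma argmin_regularization_nonempty:
  fixes g :: "'a::euclidean_space \<Rightarrow> real"
  assumes "continuous_on UNIV g" "argmin_set g \<noteq> {}" "\<epsilon> > 0"
  shows "argmin_set (\<lambda>u. g u + \<epsilon> / 2 * (norm u)\<^sup>2) \<noteq> {}"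
proof -
  obtain p where p: "\<And>y. g p \<le> g y"
    using assms(2) unfolding ex_in_conv[symmetric] mem_argmin_set_iff by blast
  let ?h = "\<lambda>u. g u + \<epsilon> / 2 * (norm u)\<^sup>2"
  have "continuous_on (cball 0 (norm p)) ?h"
    by (intro continuous_intros continuous_on_subset[OF assms(1)]) auto
  then obtain x where x: "\<And>y. y \<in> cball 0 (norm p) \<Longrightarrow> ?h x \<le> ?h y"
    using continuous_attains_inf[OF compact_cball, of 0 "norm p" ?h] norm_ge_zero[of p]
    by (metis centre_in_cball empty_iff)
  have "?h x \<le> ?h y" for y
  proof (cases "norm y \<le> norm p")
    case False
    then have "\<epsilon> / 2 * (norm p)\<^sup>2 \<le> \<epsilon> / 2 * (norm y)\<^sup>2"
      using \<open>\<epsilon> > 0\<close> by (intro mult_left_mono power_mono) auto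
    with p[of y] x[of p] show ?thesis by simp
  qed (use x in simp)
  then have "x \<in> argmin_set ?h"
    by (simp add: mem_argmin_set_iff)
  then show ?thesis
    unfolding ex_in_conv[symmetric] ..
qed

section \<open>Critical points of the regularized problem\<close>

lemma argmin_regularization_critical:
  fixes g :: "'a::euclidean_space \<Rightarrow> real"
  assumes x: "x \<in> argmin_set (\<lambda>u. g u + \<epsilon> / 2 * (norm u)\<^sup>2)" and g: "g differentiable (at x)"
  shows "gradient g x + \<epsilon> *\<^sub>R x = 0"
proof -
  \<comment> \<open>The squared norm is written as an inner product, whose derivative rule also
    covers the origin.\<close>
  let ?h = "\<lambda>u. g u + \<epsilon> / 2 * (u \<bullet> u)"
  have "(g has_derivative (\<lambda>h. h \<bullet> gradient g x)) (at x)"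
    using differentiable_imp_GDERIV_gradient[OF g] by (simp add: gderiv_def)
  then have "(?h has_derivative (\<lambda>h. h \<bullet> (gradient g x + \<epsilon> *\<^sub>R x))) (at x)"
    by (auto intro!: derivative_eq_intros simp: inner_add_right inner_commute algebra_simps)
  then have "(\<lambda>h. h \<bullet> (gradient g x + \<epsilon> *\<^sub>R x)) = (\<lambda>h. 0)"
    by (rule has_derivative_local_min)
      (use x in \<open>auto simp: mem_argmin_set_iff power2_norm_eq_inner\<close>)
  then show ?thesis
    by (metis inner_eq_zero_iff)
qed

text \<open>The sum of the two gradient inequalities, taken at \<open>x\<close> and at
  \<open>y\<close>.\<close>

lemma convex_gradient_monotone:
  fixes g :: "'a::euclidean_space \<Rightarrow> real"
  assumes "convex_on UNIV g" "\<And>x. g differentiable (at x)"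
  shows "(gradient g x - gradient g y) \<bullet> (x - y) \<ge> 0"
  using convex_on_imp_above_gradient[OF assms(1) assms(2), of x y]
    convex_on_imp_above_gradient[OF assms(1) assms(2), of y x]
  by (simp add: inner_diff_left inner_diff_right inner_commute)

text \<open>Adding \<open>\<epsilon>\<close> times the identity makes the gradient strongly
  monotone, so the residual at any \<open>y\<close> controls the distance to the critical point.
  Uniqueness, local Lipschitz continuity in the parameter and continuity at positive
  \<open>\<epsilon>\<close> all rest on this estimate.\<close>

lemma regularized_critical_distance:
  fixes g :: "'a::euclidean_space \<Rightarrow> real"
  assumes "convex_on UNIV g" "\<And>x. g differentiable (at x)" "\<epsilon> > 0"
    and x: "gradient g x + \<epsilon> *\<^sub>R x = 0"
  shows "\<epsilon> * norm (x - y) \<le> norm (gradient g y + \<epsilon> *\<^sub>R y)"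
proof (cases "x = y")
  case False
  have "\<epsilon> * (norm (x - y))\<^sup>2 \<le> (gradient g x - gradient g y) \<bullet> (x - y) + \<epsilon> * ((x - y) \<bullet> (x - y))"
    using convex_gradient_monotone[OF assms(1,2), of x y] by (simp add: power2_norm_eq_inner)
  also have "\<dots> = ((gradient g x + \<epsilon> *\<^sub>R x) - (gradient g y + \<epsilon> *\<^sub>R y)) \<bullet> (x - y)"
    by (simp add: algebra_simps)
  also have "\<dots> = - (gradient g y + \<epsilon> *\<^sub>R y) \<bullet> (x - y)"
    by (simp only: x) simp
  also have "\<dots> \<le> norm (gradient g y + \<epsilon> *\<^sub>R y) * norm (x - y)"
    by (metis norm_cauchy_schwarz norm_minus_cancel)
  finally show ?thesis
    using False by (simp add: power2_eq_square)
qed (use assms in simp)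

lemma regularization_critical_unique:
  fixes g :: "'a::euclidean_space \<Rightarrow> real"
  assumes g: "convex_on UNIV g" "\<And>x. g differentiable (at x)" "\<epsilon> > 0"
    and crit: "gradient g x + \<epsilon> *\<^sub>R x = 0" "gradient g y + \<epsilon> *\<^sub>R y = 0"
  shows "x = y"
proof -
  have "\<epsilon> * norm (x - y) \<le> 0"
    using regularized_critical_distance[OF g crit(1), of y] unfolding crit(2) norm_zero .
  then show ?thesis
    using \<open>\<epsilon> > 0\<close> by (simp add: mult_le_0_iff)
qed

section \<open>Block vectors and the range condition\<close>

lemma x_part_joint [simp]: "x_part (joint x \<theta>) = x"
  and \<theta>_part_joint [simp]: "\<theta>_part (joint x \<theta>) = \<theta>"
  by (simp_all add: x_part_def \<theta>_part_def joint_def vec_eq_iff)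

lemma bounded_linear_x_part: "bounded_linear x_part"
  unfolding linear_conv_bounded_linear[symmetric]
  by (rule linearI) (simp_all add: x_part_def vec_eq_iff)

lemma bounded_linear_\<theta>_part: "bounded_linear \<theta>_part"
  unfolding linear_conv_bounded_linear[symmetric]
  by (rule linearI) (simp_all add: \<theta>_part_def vec_eq_iff)

lemma joint_diff: "joint x \<theta> - joint y \<eta> = joint (x - y) (\<theta> - \<eta>)"
  by (simp add: joint_def vec_eq_iff split: sum.split)

lemma sum_UNIV_sum_type:
  fixes h :: "'a::finite + 'b::finite \<Rightarrow> 'c::comm_monoid_add"
  shows "(\<Sum>k\<in>UNIV. h k) = (\<Sum>i\<in>UNIV. h (Inl i)) + (\<Sum>j\<in>UNIV. h (Inr j))"
  by (simp add: sum.Plus flip: UNIV_Plus_UNIV)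

lemma norm_joint_le: "norm (joint x \<theta>) \<le> norm x + norm \<theta>"
proof -
  have "joint x \<theta> \<bullet> joint x \<theta> = x \<bullet> x + \<theta> \<bullet> \<theta>"
    by (simp add: inner_vec_def sum_UNIV_sum_type joint_def)
  then have "norm (joint x \<theta>) = norm (x, \<theta>)"
    by (simp add: norm_eq_sqrt_inner)
  then show ?thesis
    by (simp add: norm_Pair_le)
qed

lemma matrix_vector_mult_blocks:
  "V *v z = x_block V *v x_part z + \<theta>_block V *v \<theta>_part z"
  by (simp add: vec_eq_iff matrix_vector_mult_def sum_UNIV_sum_type
      x_block_def \<theta>_block_def x_part_def \<theta>_part_def)

lemma grad_x_joint: "grad_x f (joint x \<theta>) = gradient (\<lambda>u. f u \<theta>) x"
  by (simp add: grad_x_def)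

lemma lipschitz_on_joint:
  assumes "A-lipschitz_on T g" "B-lipschitz_on T h"
  shows "(A + B)-lipschitz_on T (\<lambda>t. joint (g t) (h t))"
proof (rule lipschitz_onI)
  fix s t assume "s \<in> T" "t \<in> T"
  then have "dist (g s) (g t) \<le> A * dist s t" "dist (h s) (h t) \<le> B * dist s t"
    using assms by (auto dest: lipschitz_onD)
  then show "dist (joint (g s) (h s)) (joint (g t) (h t)) \<le> (A + B) * dist s t"
    using norm_joint_le[of "g s - g t" "h s - h t"]
    by (simp add: dist_norm joint_diff distrib_right)
qed (use assms in \<open>simp add: lipschitz_on_nonneg add_nonneg_nonneg\<close>)

section \<open>Linear systems under the range condition\<close>

lemma matrix_vector_mult_minus:
  fixes A :: "real^'n^'q"
  shows "(- A) *v x = - (A *v x)" "A *v (- x) = - (A *v x)"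
  by (simp_all add: vec_eq_iff matrix_vector_mult_def sum_negf)

text \<open>With \<open>u = W *v v\<close> the equation reads
  \<open>H *v (w + u) = - \<epsilon> *\<^sub>R w\<close>. Testing semidefiniteness on
  \<open>w + u\<close> gives a nonpositive inner product of \<open>w + u\<close> with
  \<open>w\<close>, and Cauchy-Schwarz then gives a bound free of \<open>\<epsilon>\<close>.\<close>

lemma norm_solution_le_of_range:
  fixes H :: "real^'n^'n" and W :: "real^'m^'n"
  assumes psd: "\<And>v. 0 \<le> v \<bullet> (H *v v)" and "\<epsilon> > 0"
    and eq: "H *v w + \<epsilon> *\<^sub>R w + (H ** W) *v v = 0"
  shows "norm w \<le> norm (W *v v)"
proof (cases "w = 0")
  case False
  define u where "u = W *v v"
  have "H *v (w + u) = - \<epsilon> *\<^sub>R w"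
    using eq by (simp add: u_def matrix_vector_right_distrib add_eq_0_iff2 matrix_vector_mul_assoc algebra_simps)
  then have "0 \<le> - \<epsilon> * ((w + u) \<bullet> w)"
    using psd[of "w + u"] by simp
  then have "(w + u) \<bullet> w \<le> 0"
    using \<open>\<epsilon> > 0\<close> by (simp add: mult_le_0_iff zero_le_mult_iff)
  then have "norm w * norm w \<le> - u \<bullet> w"
    by (simp add: inner_add_left dot_square_norm power2_eq_square)
  also have "\<dots> \<le> norm u * norm w"
    by (metis norm_cauchy_schwarz norm_minus_cancel)
  finally show ?thesis
    using False by (simp add: u_def)
qed simp

text \<open>The image of \<open>v\<close> solves the linear equation of
  \<open>norm_solution_le_of_range\<close>. The bound is therefore uniform in
  \<open>\<epsilon>\<close>, although the inverse matrix alone may blow up as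
  \<open>\<epsilon>\<close> tends to 0.\<close>

lemma op_norm_regularized_solution_le:
  fixes H :: "real^'n^'n" and W :: "real^'m^'n"
  assumes psd: "\<And>v. 0 \<le> v \<bullet> (H *v v)" and "\<epsilon> > 0"
  shows "op_norm (- (matrix_inv (H + \<epsilon> *\<^sub>R mat 1) ** (H ** W))) \<le> op_norm W"
proof -
  let ?A = "H + \<epsilon> *\<^sub>R mat 1"
  have A: "?A *v x = H *v x + \<epsilon> *\<^sub>R x" for x
    by (simp add: matrix_vector_mult_add_rdistrib scaleR_matrix_vector_assoc[symmetric])
  \<comment> \<open>The same estimate with zero right-hand side shows that the kernel is
    trivial.\<close>
  have "x = 0" if "?A *v x = 0" for x
    using norm_solution_le_of_range[OF psd \<open>\<epsilon> > 0\<close>, of x 0 "0 :: real^'m"] that by (simp add: A)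
  then have "invertible ?A"
    unfolding invertible_left_inverse matrix_left_invertible_ker by blast
  then have inv: "?A ** matrix_inv ?A = mat 1"
    unfolding invertible_def matrix_inv_def by (rule someI2_ex) simp
  have "norm (- (matrix_inv ?A ** (H ** W)) *v v) \<le> op_norm W * norm v" for v
  proof -
    let ?w = "- (matrix_inv ?A ** (H ** W)) *v v"
    have "?A *v ?w = - ((?A ** matrix_inv ?A) *v ((H ** W) *v v))"
      by (simp only: matrix_vector_mult_minus matrix_vector_mul_assoc matrix_mul_assoc)
    then have "H *v ?w + \<epsilon> *\<^sub>R ?w + (H ** W) *v v = 0"
      unfolding A inv by simp
    then have "norm ?w \<le> norm (W *v v)"
      by (rule norm_solution_le_of_range[OF psd \<open>\<epsilon> > 0\<close>])
    also have "\<dots> \<le> op_norm W * norm v"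
      by (rule norm_mult_le_op_norm)
    finally show ?thesis .
  qed
  then show ?thesis
    unfolding op_norm_def[of "- _"] by (rule onorm_le)
qed

section \<open>The regularized selection\<close>

lemma regularityD:
  assumes "regularity f \<Theta>" "\<theta> \<in> \<Theta>"
  shows "(\<lambda>x. f x \<theta>) differentiable (at x)" "convex_on UNIV (\<lambda>x. f x \<theta>)"
    "argmin_set (\<lambda>x. f x \<theta>) \<noteq> {}" "continuous_on UNIV (\<lambda>x. f x \<theta>)"
proof -
  show diff: "(\<lambda>x. f x \<theta>) differentiable (at x)" for x
    using assms by (simp add: regularity_def)
  show "continuous_on UNIV (\<lambda>x. f x \<theta>)"
    using diff by (auto intro!: continuous_at_imp_continuous_on differentiable_imp_continuous_within)
qed (use assms in \<open>auto simp: regularity_def\<close>)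

text \<open>Every minimizer solves the critical equation, which has at most one solution; together
  with existence this makes the \<open>THE\<close> in \<open>x_reg\<close> meaningful.\<close>

lemma x_reg_in_argmin_set:
  assumes reg: "regularity f \<Theta>" and \<theta>: "\<theta> \<in> \<Theta>" and "\<epsilon> > 0"
  shows "x_reg f \<epsilon> \<theta> \<in> argmin_set (\<lambda>u. f u \<theta> + \<epsilon> / 2 * (norm u)\<^sup>2)"
proof -
  note R = regularityD[OF reg \<theta>]
  have "argmin_set (\<lambda>u. f u \<theta> + \<epsilon> / 2 * (norm u)\<^sup>2) \<noteq> {}"
    by (rule argmin_regularization_nonempty[OF R(4) R(3) \<open>\<epsilon> > 0\<close>])
  then obtain x where x: "x \<in> argmin_set (\<lambda>u. f u \<theta> + \<epsilon> / 2 * (norm u)\<^sup>2)"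
    by (meson all_not_in_conv)
  have "y = x" if "y \<in> argmin_set (\<lambda>u. f u \<theta> + \<epsilon> / 2 * (norm u)\<^sup>2)" for y
    by (rule regularization_critical_unique[OF R(2,1) \<open>\<epsilon> > 0\<close>
          argmin_regularization_critical[OF that R(1)] argmin_regularization_critical[OF x R(1)]])
  with x show ?thesis
    unfolding x_reg_def by (rule theI)
qed

lemma x_reg_critical:
  assumes "regularity f \<Theta>" "\<theta> \<in> \<Theta>" "\<epsilon> > 0"
  shows "grad_x f (joint (x_reg f \<epsilon> \<theta>) \<theta>) + \<epsilon> *\<^sub>R x_reg f \<epsilon> \<theta> = 0"
  unfolding grad_x_joint
  by (rule argmin_regularization_critical[OF x_reg_in_argmin_set[OF assms] regularityD(1)[OF assms(1,2)]])

lemma x_reg_distance: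
  assumes "regularity f \<Theta>" "\<theta> \<in> \<Theta>" "\<epsilon> > 0"
  shows "\<epsilon> * norm (x_reg f \<epsilon> \<theta> - y) \<le> norm (grad_x f (joint y \<theta>) + \<epsilon> *\<^sub>R y)"
  using regularized_critical_distance[OF regularityD(2,1)[OF assms(1,2)] assms(3)
      x_reg_critical[OF assms, unfolded grad_x_joint]]
  by (simp add: grad_x_joint)

text \<open>The minimizer for one parameter is inserted into the critical equation for another; the
  residual is then a difference of \<open>grad_x f\<close> in the parameter alone. The resulting
  constant \<open>L / \<epsilon>\<close> degenerates as \<open>\<epsilon>\<close> tends to 0, so it
  serves only to make the later test curves Lipschitz for each fixed
  \<open>\<epsilon>\<close>.\<close>

lemma locally_lipschitz_on_x_reg:
  assumes reg: "regularity f \<Theta>" and "\<epsilon> > 0"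
  shows "locally_lipschitz_on \<Theta> (x_reg f \<epsilon>)"
  unfolding locally_lipschitz_on_def
proof
  fix \<theta>\<^sub>0 assume \<theta>\<^sub>0: "\<theta>\<^sub>0 \<in> \<Theta>"
  define X where "X = x_reg f \<epsilon>"
  let ?z = "joint (X \<theta>\<^sub>0) \<theta>\<^sub>0"
  obtain r L where "r > 0" and L: "L-lipschitz_on (ball ?z r \<inter> {z. \<theta>_part z \<in> \<Theta>}) (grad_x f)"
    using regularity_def[THEN iffD1, OF reg, THEN conjunct2, unfolded locally_lipschitz_on_def,
        rule_format, of ?z] \<theta>\<^sub>0 by auto
  have L0: "L \<ge> 0"
    using L by (rule lipschitz_on_nonneg)
  have near: "joint y \<theta> \<in> ball ?z r" if "norm (y - X \<theta>\<^sub>0) + norm (\<theta> - \<theta>\<^sub>0) < r" for y \<theta>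
    using norm_joint_le[of "y - X \<theta>\<^sub>0" "\<theta> - \<theta>\<^sub>0"] that
    by (simp add: dist_commute[of ?z]) (simp add: dist_norm joint_diff)
  \<comment> \<open>Only \<open>X \<eta>\<close> has to be known to lie near
    \<open>X \<theta>\<^sub>0\<close>; nothing is asked of \<open>X \<theta>\<close>. This avoids
    circularity when closeness itself is derived from this estimate.\<close>
  have step: "\<epsilon> * norm (X \<theta> - X \<eta>) \<le> L * norm (\<theta> - \<eta>)"
    if "\<theta> \<in> \<Theta>" "\<eta> \<in> \<Theta>" "norm (X \<eta> - X \<theta>\<^sub>0) + norm (\<theta> - \<theta>\<^sub>0) < r" "norm (X \<eta> - X \<theta>\<^sub>0) + norm (\<eta> - \<theta>\<^sub>0) < r"
    for \<theta> \<eta>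
  proof -
    have "\<epsilon> * norm (X \<theta> - X \<eta>) \<le> norm (grad_x f (joint (X \<eta>) \<theta>) + \<epsilon> *\<^sub>R X \<eta>)"
      unfolding X_def by (rule x_reg_distance[OF reg that(1) \<open>\<epsilon> > 0\<close>])
    also have "\<epsilon> *\<^sub>R X \<eta> = - grad_x f (joint (X \<eta>) \<eta>)"
      using x_reg_critical[OF reg that(2) \<open>\<epsilon> > 0\<close>] by (simp add: X_def add_eq_0_iff)
    also have "norm (grad_x f (joint (X \<eta>) \<theta>) + - grad_x f (joint (X \<eta>) \<eta>))
        \<le> L * norm (joint (X \<eta>) \<theta> - joint (X \<eta>) \<eta>)"
      using lipschitz_on_normD[OF L, of "joint (X \<eta>) \<theta>" "joint (X \<eta>) \<eta>"] that near by simp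
    also have "\<dots> \<le> L * norm (\<theta> - \<eta>)"
      using norm_joint_le[of "X \<eta> - X \<eta>" "\<theta> - \<eta>"] L0 by (simp add: joint_diff mult_left_mono)
    finally show ?thesis .
  qed
  \<comment> \<open>The radius \<open>s\<close> satisfies
    \<open>(1 + L / \<epsilon>) * s = r / 2\<close>, which leaves room for the displacement of the
    minimizer plus that of the parameter.\<close>
  define k where "k = 1 + L / \<epsilon>"
  have "k \<ge> 1"
    using L0 \<open>\<epsilon> > 0\<close> by (simp add: k_def)
  define s where "s = r / k / 2"
  have "s > 0"
    using \<open>r > 0\<close> \<open>k \<ge> 1\<close> by (simp add: s_def)
  have "k * s = r / 2"
    using \<open>k \<ge> 1\<close> by (simp add: s_def)
  then have s: "L / \<epsilon> * s + s < r"
    using \<open>r > 0\<close> unfolding k_def by (simp only: distrib_right)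
  moreover have "0 \<le> L / \<epsilon> * s"
    using L0 \<open>\<epsilon> > 0\<close> \<open>s > 0\<close> by simp
  ultimately have "s < r"
    by linarith
  \<comment> \<open>The case \<open>\<eta> = \<theta>\<^sub>0\<close> of \<open>step\<close>, which
    then supplies the closeness required for arbitrary pairs.\<close>
  have close: "norm (X \<theta> - X \<theta>\<^sub>0) \<le> L / \<epsilon> * s" if "\<theta> \<in> ball \<theta>\<^sub>0 s \<inter> \<Theta>" for \<theta>
  proof -
    have "norm (\<theta> - \<theta>\<^sub>0) < s"
      using that by (simp add: dist_norm norm_minus_commute)
    then have "\<epsilon> * norm (X \<theta> - X \<theta>\<^sub>0) \<le> L * norm (\<theta> - \<theta>\<^sub>0)"
      using that \<theta>\<^sub>0 \<open>s < r\<close> \<open>r > 0\<close> by (intro step) auto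
    also have "\<dots> \<le> L * s"
      using \<open>norm (\<theta> - \<theta>\<^sub>0) < s\<close> L0 by (intro mult_left_mono) auto
    finally show ?thesis
      using \<open>\<epsilon> > 0\<close> by (simp add: field_simps)
  qed
  have "(L / \<epsilon>)-lipschitz_on (ball \<theta>\<^sub>0 s \<inter> \<Theta>) X"
  proof (rule lipschitz_onI)
    fix \<theta> \<eta> assume *: "\<theta> \<in> ball \<theta>\<^sub>0 s \<inter> \<Theta>" "\<eta> \<in> ball \<theta>\<^sub>0 s \<inter> \<Theta>"
    then have "norm (\<theta> - \<theta>\<^sub>0) < s" "norm (\<eta> - \<theta>\<^sub>0) < s"
      by (simp_all add: dist_norm norm_minus_commute)
    then have "\<epsilon> * norm (X \<theta> - X \<eta>) \<le> L * norm (\<theta> - \<eta>)"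
      using * close[OF *(2)] s by (intro step) auto
    then show "dist (X \<theta>) (X \<eta>) \<le> L / \<epsilon> * dist \<theta> \<eta>"
      using \<open>\<epsilon> > 0\<close> by (simp add: dist_norm field_simps)
  qed (use L0 \<open>\<epsilon> > 0\<close> in simp)
  then show "\<exists>r>0. \<exists>L. L-lipschitz_on (ball \<theta>\<^sub>0 r \<inter> \<Theta>) (x_reg f \<epsilon>)"
    using \<open>s > 0\<close> unfolding X_def by blast
qed

text \<open>The chain rule is applied to \<open>grad_x f\<close> along the lifted segment
  \<open>z\<close>, whose \<open>x\<close>-part is the minimizer. The critical equation then yields
  a linear equation for the velocity of the minimizer, and \<open>norm_solution_le_of_range\<close>
  bounds that velocity independently of \<open>\<epsilon>\<close>.\<close>

lemma x_reg_lipschitz_of_range_condition: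
  fixes f :: "real^'n \<Rightarrow> real^'m \<Rightarrow> real"
  assumes reg: "regularity f \<Theta>" and "U \<subseteq> \<Theta>" and "\<epsilon> > 0" "C \<ge> 0"
    and J: "conservative_jacobian {z. \<theta>_part z \<in> U} (grad_x f) J"
    and K: "convex K" "compact K" "K \<subseteq> U"
    and range: "\<And>\<theta> V. \<theta> \<in> K \<Longrightarrow> V \<in> J (joint (x_reg f \<epsilon> \<theta>) \<theta>) \<Longrightarrow>
      (\<forall>v. 0 \<le> v \<bullet> (x_block V *v v)) \<and> (\<exists>W. \<theta>_block V = x_block V ** W \<and> op_norm W \<le> C)"
  shows "C-lipschitz_on K (x_reg f \<epsilon>)"
proof (rule lipschitz_on_of_AE_derivative_bound[OF K(1,2) _ locally_lipschitz_on_x_reg[OF reg \<open>\<epsilon> > 0\<close>] \<open>C \<ge> 0\<close>])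
  show "K \<subseteq> \<Theta>"
    using K(3) \<open>U \<subseteq> \<Theta>\<close> by blast
  fix a b assume ab: "a \<in> K" "b \<in> K"
  define X where "X = x_reg f \<epsilon>"
  define \<mu> where "\<mu> t = a + t *\<^sub>R (b - a)" for t
  define z where "z t = joint (X (\<mu> t)) (\<mu> t)" for t
  have in_K: "\<mu> t \<in> K" if "t \<in> {0..1}" for t
    using convexD_alt[OF K(1) ab, of t] that by (simp add: \<mu>_def algebra_simps)
  have z_parts [simp]: "x_part (z t) = X (\<mu> t)" "\<theta>_part (z t) = \<mu> t" for t
    by (simp_all add: z_def)
  \<comment> \<open>This constant may depend on \<open>\<epsilon>\<close>; it is used to make the
    lifted curve absolutely continuous and does not enter the conclusion.\<close>
  obtain L where L: "L-lipschitz_on K X"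
    using locally_lipschitz_on_compact[OF locally_lipschitz_on_x_reg[OF reg \<open>\<epsilon> > 0\<close>] K(2) \<open>K \<subseteq> \<Theta>\<close>]
    unfolding X_def .
  have \<mu>_lip: "(norm (b - a))-lipschitz_on {0..1} \<mu>"
    unfolding \<mu>_def by (rule segment_lipschitz)
  have "(L * norm (b - a))-lipschitz_on {0..1} (\<lambda>t. X (\<mu> t))"
    using in_K by (intro lipschitz_on_compose2[OF \<mu>_lip] lipschitz_on_subset[OF L]) auto
  then have "(L * norm (b - a) + norm (b - a))-lipschitz_on {0..1} z"
    unfolding z_def by (rule lipschitz_on_joint[OF _ \<mu>_lip])
  then have "absolutely_continuous_curve z"
    by (rule lipschitz_on_absolutely_continuous_curve)
  moreover have "z ` {0..1} \<subseteq> {z. \<theta>_part z \<in> U}"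
    using in_K K(3) by auto
  ultimately have "AE t in lebesgue_on {0..1}.
           \<exists>v. (z has_vector_derivative v) (at t within {0..1}) \<and>
               (\<forall>V\<in>J (z t). ((\<lambda>s. grad_x f (z s)) has_vector_derivative V *v v) (at t within {0..1}))"
    using J unfolding conservative_jacobian_def by blast
  with AE_space show "AE t in lebesgue_on {0..1}. \<exists>w.
      ((\<lambda>t. x_reg f \<epsilon> (a + t *\<^sub>R (b - a))) has_vector_derivative w) (at t within {0..1}) \<and>
      norm w \<le> C * norm (b - a)"
    unfolding \<mu>_def[symmetric] X_def[symmetric]
  proof eventually_elim
    case (elim t)
    then have t: "t \<in> {0..1}" by simp
    from elim obtain v where v: "(z has_vector_derivative v) (at t within {0..1})"
      "\<And>V. V \<in> J (z t) \<Longrightarrow> ((\<lambda>s. grad_x f (z s)) has_vector_derivative V *v v) (at t within {0..1})"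
      by blast
    have nontriv: "at t within {0..1} \<noteq> bot"
      using t by (auto simp: trivial_limit_within islimpt_Icc)
    have X': "((\<lambda>t. X (\<mu> t)) has_vector_derivative x_part v) (at t within {0..1})"
      using bounded_linear.has_vector_derivative[OF bounded_linear_x_part v(1)] by simp
    have "(\<mu> has_vector_derivative \<theta>_part v) (at t within {0..1})"
      using bounded_linear.has_vector_derivative[OF bounded_linear_\<theta>_part v(1)] by simp
    moreover have "(\<mu> has_vector_derivative (b - a)) (at t within {0..1})"
      unfolding \<mu>_def by (auto intro!: derivative_eq_intros)
    ultimately have \<theta>_v: "\<theta>_part v = b - a"
      using nontriv by (intro vector_derivative_unique_within)
    have "z t \<in> {z. \<theta>_part z \<in> U}"
      using in_K[OF t] K(3) by auto
    then obtain V where V: "V \<in> J (z t)"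
      using J unfolding conservative_jacobian_def by blast
    obtain W where psd: "\<And>v. 0 \<le> v \<bullet> (x_block V *v v)"
      and W: "\<theta>_block V = x_block V ** W" "op_norm W \<le> C"
      using range[OF in_K[OF t], of V] V unfolding z_def X_def by blast
    \<comment> \<open>The critical equation gives a second expression for \<open>grad_x f\<close>
      along the curve; comparing its derivative with the chain rule determines
      \<open>V *v v\<close>.\<close>
    have "grad_x f (z s) = - \<epsilon> *\<^sub>R X (\<mu> s)" if "s \<in> {0..1}" for s
      using x_reg_critical[OF reg _ \<open>\<epsilon> > 0\<close>, of "\<mu> s"] in_K[OF that] \<open>K \<subseteq> \<Theta>\<close>
      by (auto simp: z_def X_def add_eq_0_iff2)
    moreover have "((\<lambda>s. - \<epsilon> *\<^sub>R X (\<mu> s)) has_vector_derivative - \<epsilon> *\<^sub>R x_part v) (at t within {0..1})"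
      by (intro bounded_linear.has_vector_derivative[OF bounded_linear_scaleR_right] X')
    ultimately have "((\<lambda>s. grad_x f (z s)) has_vector_derivative - \<epsilon> *\<^sub>R x_part v) (at t within {0..1})"
      by (rule has_vector_derivative_transform[OF t])
    then have "V *v v = - \<epsilon> *\<^sub>R x_part v"
      by (rule vector_derivative_unique_within[OF nontriv v(2)[OF V]])
    then have "x_block V *v x_part v + \<epsilon> *\<^sub>R x_part v + (x_block V ** W) *v (b - a) = 0"
      unfolding matrix_vector_mult_blocks W(1) \<theta>_v by (simp add: algebra_simps)
    then have "norm (x_part v) \<le> norm (W *v (b - a))"
      by (rule norm_solution_le_of_range[OF psd \<open>\<epsilon> > 0\<close>])
    also have "\<dots> \<le> op_norm W * norm (b - a)"
      by (rule norm_mult_le_op_norm)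
    also have "\<dots> \<le> C * norm (b - a)"
      using W(2) by (simp add: mult_right_mono)
    finally show ?case
      using X' by blast
  qed
qed

section \<open>Tikhonov convergence to the minimal norm solution\<close>

text \<open>The minimal norm solution is the projection of the origin onto a nonempty closed convex
  set. The second claim is uniqueness in the form needed to exclude other limits.\<close>

lemma x_min_minimal_norm:
  assumes reg: "regularity f \<Theta>" and \<theta>: "\<theta> \<in> \<Theta>"
  shows "x_min f \<theta> \<in> argmin_set (\<lambda>u. f u \<theta>)"
    and "\<And>y. y \<in> argmin_set (\<lambda>u. f u \<theta>) \<Longrightarrow> norm y \<le> norm (x_min f \<theta>) \<Longrightarrow> y = x_min f \<theta>"
proof -
  let ?A = "argmin_set (\<lambda>u. f u \<theta>)"
  note R = regularityD[OF reg \<theta>]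
  note A = argmin_set_closed_convex[OF R(4,2)]
  obtain p where p: "p \<in> ?A" "\<And>y. y \<in> ?A \<Longrightarrow> dist 0 p \<le> dist 0 y"
    using distance_attains_inf[OF A(1) R(3)] by metis
  have unique: "y = p" if "y \<in> ?A" "norm y \<le> norm p" for y
  proof (rule any_closest_point_unique[OF A(2,1) that(1) p(1)])
    show "\<forall>z\<in>?A. dist 0 y \<le> dist 0 z" "\<forall>z\<in>?A. dist 0 p \<le> dist 0 z"
      using p(2) that(2) by (auto intro: order_trans)
  qed
  have "is_arg_min norm (\<lambda>y. y \<in> ?A) x \<longleftrightarrow> x = p" for x
    using p unique by (auto simp: is_arg_min_linorder)
  then have "x_min f \<theta> = p"
    unfolding x_min_def by (intro the_equality) blast+
  with p unique show "x_min f \<theta> \<in> ?A"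
    and "\<And>y. y \<in> ?A \<Longrightarrow> norm y \<le> norm (x_min f \<theta>) \<Longrightarrow> y = x_min f \<theta>"
    by blast+
qed

text \<open>Comparison with \<open>p\<close> confines the regularized minimizers to the ball of
  radius \<open>norm p\<close>. On the part of this ball at distance at least
  \<open>\<delta>\<close> from \<open>p\<close>, compactness and uniqueness give a gap
  \<open>\<eta>\<close> above the minimal value, which the penalty cannot compensate once
  \<open>\<epsilon>\<close> is small.\<close>

lemma x_reg_tendsto_x_min:
  assumes reg: "regularity f \<Theta>" and \<theta>: "\<theta> \<in> \<Theta>"
  shows "((\<lambda>\<epsilon>. x_reg f \<epsilon> \<theta>) \<longlongrightarrow> x_min f \<theta>) (at_right 0)"
proof (rule tendstoI)
  fix \<delta> :: real assume "\<delta> > 0"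
  define p where "p = x_min f \<theta>"
  define g where "g u = f u \<theta>" for u
  note R = regularityD[OF reg \<theta>, folded g_def]
  have p: "g p \<le> g y" for y
    using x_min_minimal_norm(1)[OF reg \<theta>] unfolding p_def g_def mem_argmin_set_iff by blast
  let ?A = "cball 0 (norm p) - ball p \<delta>"
  have "\<exists>\<eta>>0. \<forall>x\<in>?A. g p + \<eta> \<le> g x"
  proof (cases "?A = {}")
    case True
    show ?thesis unfolding True by (intro exI[of _ 1]) simp
  next
    case False
    have "compact ?A"
      by (intro compact_diff) auto
    then obtain a where a: "a \<in> ?A" "\<forall>x\<in>?A. g a \<le> g x"
      using continuous_attains_inf[OF _ False continuous_on_subset[OF R(4) subset_UNIV]] by blast
    have "g a \<noteq> g p"
    proof
      assume "g a = g p"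
      then have "a \<in> argmin_set (\<lambda>u. f u \<theta>)"
        using p unfolding mem_argmin_set_iff g_def by simp
      then have "a = p"
        using a(1) x_min_minimal_norm(2)[OF reg \<theta>] unfolding p_def by simp
      with a(1) \<open>\<delta> > 0\<close> show False by simp
    qed
    with p[of a] have "g a - g p > 0" by simp
    then show ?thesis
      using a(2) by (intro exI[of _ "g a - g p"]) simp
  qed
  then obtain \<eta> where "\<eta> > 0" and \<eta>: "\<And>x. x \<in> ?A \<Longrightarrow> g p + \<eta> \<le> g x"
    by blast
  \<comment> \<open>This threshold makes the penalty at \<open>p\<close> smaller than the gap; the
    summand 1 keeps the denominator positive when \<open>p\<close> is 0.\<close>
  have "eventually (\<lambda>\<epsilon>. \<epsilon> < \<eta> / ((norm p)\<^sup>2 + 1)) (at_right 0)"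
    unfolding eventually_at_right_field using \<open>\<eta> > 0\<close>
    by (intro exI[of _ "\<eta> / ((norm p)\<^sup>2 + 1)"]) (simp add: add_nonneg_pos)
  moreover have "eventually (\<lambda>\<epsilon>::real. \<epsilon> > 0) (at_right 0)"
    by (rule eventually_at_right_less)
  ultimately show "eventually (\<lambda>\<epsilon>. dist (x_reg f \<epsilon> \<theta>) (x_min f \<theta>) < \<delta>) (at_right 0)"
    unfolding p_def[symmetric]
  proof eventually_elim
    case (elim \<epsilon>)
    let ?x = "x_reg f \<epsilon> \<theta>"
    have "0 < (norm p)\<^sup>2 + 1"
      by (simp add: add_nonneg_pos)
    with elim have small: "\<epsilon> * (norm p)\<^sup>2 + \<epsilon> < \<eta>"
      by (simp add: pos_less_divide_eq algebra_simps)
    have le: "g ?x + \<epsilon> / 2 * (norm ?x)\<^sup>2 \<le> g p + \<epsilon> / 2 * (norm p)\<^sup>2"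
      using x_reg_in_argmin_set[OF reg \<theta> elim(2)] unfolding mem_argmin_set_iff g_def by blast
    then have "\<epsilon> / 2 * (norm ?x)\<^sup>2 \<le> \<epsilon> / 2 * (norm p)\<^sup>2"
      using p[of ?x] by linarith
    then have "(norm ?x)\<^sup>2 \<le> (norm p)\<^sup>2"
      using elim(2) by (simp only: mult_le_cancel_left_pos half_gt_zero)
    then have "norm ?x \<le> norm p"
      by (rule power2_le_imp_le) simp
    have "\<not> \<delta> \<le> dist p ?x"
    proof
      assume "\<delta> \<le> dist p ?x"
      then have "g p + \<eta> \<le> g ?x"
        using \<open>norm ?x \<le> norm p\<close> by (intro \<eta>) auto
      moreover have "0 \<le> \<epsilon> / 2 * (norm ?x)\<^sup>2" "0 \<le> \<epsilon> / 2 * (norm p)\<^sup>2"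
        using elim(2) by auto
      ultimately show False
        using le small elim(2) by linarith
    qed
    then show ?case
      by (simp add: dist_commute)
  qed
qed

section \<open>Continuity of the joint selection\<close>

text \<open>A Lipschitz inequality with a common constant survives the pointwise limit, which
  extends it to \<open>\<epsilon> = 0\<close>.\<close>

lemma x_star_lipschitz_on:
  assumes reg: "regularity f \<Theta>" and "T \<subseteq> \<Theta>"
    and lip: "\<And>\<epsilon>. 0 < \<epsilon> \<Longrightarrow> \<epsilon> \<le> e \<Longrightarrow> C-lipschitz_on T (x_reg f \<epsilon>)"
    and "e > 0" "0 \<le> \<epsilon>" "\<epsilon> \<le> e"
  shows "C-lipschitz_on T (\<lambda>\<theta>. x_star f (\<theta>, \<epsilon>))"
proof (cases "\<epsilon> > 0")
  case True
  then show ?thesis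
    using lip assms(6) by (simp add: x_star_def)
next
  case False
  have "C-lipschitz_on T (x_min f)"
  proof (rule lipschitz_onI)
    fix \<theta> \<eta> assume *: "\<theta> \<in> T" "\<eta> \<in> T"
    have "((\<lambda>\<epsilon>. dist (x_reg f \<epsilon> \<theta>) (x_reg f \<epsilon> \<eta>)) \<longlongrightarrow> dist (x_min f \<theta>) (x_min f \<eta>)) (at_right 0)"
      using * \<open>T \<subseteq> \<Theta>\<close> by (intro tendsto_dist x_reg_tendsto_x_min[OF reg]) auto
    moreover have "eventually (\<lambda>\<epsilon>. dist (x_reg f \<epsilon> \<theta>) (x_reg f \<epsilon> \<eta>) \<le> C * dist \<theta> \<eta>) (at_right 0)"
      unfolding eventually_at_right_field
      using \<open>e > 0\<close> lipschitz_onD[OF lip * ] by (intro exI[of _ e]) auto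
    ultimately show "dist (x_min f \<theta>) (x_min f \<eta>) \<le> C * dist \<theta> \<eta>"
      by (rule tendsto_upperbound) simp
  next
    show "0 \<le> C"
      using lip[of e] \<open>e > 0\<close> by (auto intro: lipschitz_on_nonneg)
  qed
  then show ?thesis
    using False by (simp add: x_star_def)
qed

text \<open>The minimizer \<open>y\<close> at the base point is kept fixed while both parameters
  vary; the residual estimate bounds the displacement from \<open>y\<close> by a continuous function
  that vanishes at the base point.\<close>

lemma continuous_x_star_positive:
  assumes reg: "regularity f \<Theta>" and "U \<subseteq> \<Theta>" and p: "\<theta>\<^sub>0 \<in> U" "\<epsilon>\<^sub>0 > 0"
  shows "continuous (at (\<theta>\<^sub>0, \<epsilon>\<^sub>0) within U \<times> {0..}) (x_star f)"
proof -
  let ?F = "at (\<theta>\<^sub>0, \<epsilon>\<^sub>0) within U \<times> {0..}"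
  define y where "y = x_reg f \<epsilon>\<^sub>0 \<theta>\<^sub>0"
  define h where "h q = norm (grad_x f (joint y (fst q)) + snd q *\<^sub>R y) / snd q" for q :: "_ \<times> real"
  have fst: "(fst \<longlongrightarrow> \<theta>\<^sub>0) ?F" and snd: "(snd \<longlongrightarrow> \<epsilon>\<^sub>0) ?F"
    using tendsto_fst[OF tendsto_ident_at, of "(\<theta>\<^sub>0, \<epsilon>\<^sub>0)"] tendsto_snd[OF tendsto_ident_at, of "(\<theta>\<^sub>0, \<epsilon>\<^sub>0)"]
    by simp_all
  have "continuous_on UNIV (joint y)"
  proof (rule lipschitz_on_continuous_on)
    show "1-lipschitz_on UNIV (joint y)"
      using norm_joint_le[of "y - y"] by (intro lipschitz_onI) (simp_all add: dist_norm joint_diff)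
  qed
  moreover have "continuous_on {z. \<theta>_part z \<in> \<Theta>} (grad_x f)"
    using reg by (intro locally_lipschitz_on_imp_continuous_on) (simp add: regularity_def)
  ultimately have "continuous_on U (\<lambda>\<theta>. grad_x f (joint y \<theta>))"
    using \<open>U \<subseteq> \<Theta>\<close> by (intro continuous_on_compose2[of _ "grad_x f" U "joint y"])
      (auto intro: continuous_on_subset)
  then have "((\<lambda>q. grad_x f (joint y (fst q))) \<longlongrightarrow> grad_x f (joint y \<theta>\<^sub>0)) ?F"
    by (rule continuous_on_tendsto_compose[OF _ fst p(1)]) (simp add: eventually_at_filter mem_Times_iff)
  then have "(h \<longlongrightarrow> norm (grad_x f (joint y \<theta>\<^sub>0) + \<epsilon>\<^sub>0 *\<^sub>R y) / \<epsilon>\<^sub>0) ?F"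
    unfolding h_def using p(2) by (intro tendsto_intros snd) auto
  then have h0: "(h \<longlongrightarrow> 0) ?F"
    using x_reg_critical[OF reg _ p(2), of \<theta>\<^sub>0] p(1) \<open>U \<subseteq> \<Theta>\<close> by (auto simp: y_def)
  have "eventually (\<lambda>q. snd q > 0) ?F"
    by (rule order_tendstoD(1)[OF snd p(2)])
  moreover have "eventually (\<lambda>q. fst q \<in> U) ?F"
    by (simp add: eventually_at_filter mem_Times_iff)
  ultimately have "eventually (\<lambda>q. norm (x_star f q - y) \<le> h q) ?F"
  proof eventually_elim
    case (elim q)
    then show ?case
      using x_reg_distance[OF reg _ elim(1), of "fst q" y] \<open>U \<subseteq> \<Theta>\<close>
      by (auto simp: x_star_def h_def split_beta field_simps)
  qed
  then have "((\<lambda>q. x_star f q - y) \<longlongrightarrow> 0) ?F"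
    using h0 by (rule Lim_null_comparison)
  then have "(x_star f \<longlongrightarrow> y) ?F"
    by (rule Lim_null[THEN iffD2])
  then show ?thesis
    using p(2) by (simp add: continuous_within x_star_def y_def)
qed

text \<open>The displacement is split in two: moving the parameter at fixed
  \<open>\<epsilon>\<close> costs the uniform Lipschitz bound, and moving \<open>\<epsilon>\<close>
  at fixed \<open>\<theta>\<^sub>0\<close> is Tikhonov convergence.\<close>

lemma continuous_x_star_zero:
  assumes reg: "regularity f \<Theta>" and "U \<subseteq> \<Theta>" and "\<theta>\<^sub>0 \<in> U" "r > 0" "e > 0"
    and lip: "\<And>\<epsilon>. 0 < \<epsilon> \<Longrightarrow> \<epsilon> \<le> e \<Longrightarrow> C-lipschitz_on (ball \<theta>\<^sub>0 r \<inter> U) (x_reg f \<epsilon>)"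
  shows "continuous (at (\<theta>\<^sub>0, 0) within U \<times> {0..}) (x_star f)"
proof -
  let ?F = "at (\<theta>\<^sub>0, 0::real) within U \<times> {0..}"
  have fst: "(fst \<longlongrightarrow> \<theta>\<^sub>0) ?F" and snd: "(snd \<longlongrightarrow> 0) ?F"
    using tendsto_fst[OF tendsto_ident_at, of "(\<theta>\<^sub>0, 0)"] tendsto_snd[OF tendsto_ident_at, of "(\<theta>\<^sub>0, 0)"]
    by simp_all
  have "((\<lambda>\<epsilon>. x_star f (\<theta>\<^sub>0, \<epsilon>)) \<longlongrightarrow> x_min f \<theta>\<^sub>0) (at_right 0)"
  proof (rule Lim_transform_eventually)
    show "((\<lambda>\<epsilon>. x_reg f \<epsilon> \<theta>\<^sub>0) \<longlongrightarrow> x_min f \<theta>\<^sub>0) (at_right 0)"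
      using x_reg_tendsto_x_min[OF reg] assms(2,3) by blast
    show "eventually (\<lambda>\<epsilon>. x_reg f \<epsilon> \<theta>\<^sub>0 = x_star f (\<theta>\<^sub>0, \<epsilon>)) (at_right 0)"
      by (auto simp: eventually_at_filter x_star_def)
  qed
  moreover have "at 0 within {0::real..} = at_right 0"
    by (rule at_within_Ici_at_right)
  \<comment> \<open>Continuity is needed rather than a mere right-hand limit, because nearby points
    \<open>q\<close> may have second component 0.\<close>
  ultimately have "continuous (at 0 within {0..}) (\<lambda>\<epsilon>. x_star f (\<theta>\<^sub>0, \<epsilon>))"
    by (simp add: continuous_within x_star_def)
  then have "((\<lambda>q. x_star f (\<theta>\<^sub>0, snd q)) \<longlongrightarrow> x_star f (\<theta>\<^sub>0, 0)) ?F"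
    by (rule continuous_within_tendsto_compose[OF _ _ snd]) (simp_all add: eventually_at_filter mem_Times_iff)
  then have "((\<lambda>q. C * dist (fst q) \<theta>\<^sub>0 + dist (x_star f (\<theta>\<^sub>0, snd q)) (x_star f (\<theta>\<^sub>0, 0)))
      \<longlongrightarrow> C * dist \<theta>\<^sub>0 \<theta>\<^sub>0 + dist (x_star f (\<theta>\<^sub>0, 0)) (x_star f (\<theta>\<^sub>0, 0))) ?F"
    by (intro tendsto_intros fst)
  then have lim: "((\<lambda>q. C * dist (fst q) \<theta>\<^sub>0 + dist (x_star f (\<theta>\<^sub>0, snd q)) (x_star f (\<theta>\<^sub>0, 0)))
      \<longlongrightarrow> 0) ?F"
    by simp
  have "eventually (\<lambda>q. snd q < e) ?F"
    by (rule order_tendstoD(2)[OF snd \<open>e > 0\<close>])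
  moreover have "eventually (\<lambda>q. dist (fst q) \<theta>\<^sub>0 < r) ?F"
    by (rule tendstoD[OF fst \<open>r > 0\<close>])
  moreover have "eventually (\<lambda>q. fst q \<in> U \<and> snd q \<ge> 0) ?F"
    by (simp add: eventually_at_filter mem_Times_iff)
  ultimately have "eventually (\<lambda>q. dist (x_star f q) (x_star f (\<theta>\<^sub>0, 0)) \<le>
      C * dist (fst q) \<theta>\<^sub>0 + dist (x_star f (\<theta>\<^sub>0, snd q)) (x_star f (\<theta>\<^sub>0, 0))) ?F"
  proof eventually_elim
    case (elim q)
    have "C-lipschitz_on (ball \<theta>\<^sub>0 r \<inter> U) (\<lambda>\<theta>. x_star f (\<theta>, snd q))"
      using elim \<open>U \<subseteq> \<Theta>\<close> by (intro x_star_lipschitz_on[OF reg _ lip \<open>e > 0\<close>]) auto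
    then have "dist (x_star f (fst q, snd q)) (x_star f (\<theta>\<^sub>0, snd q)) \<le> C * dist (fst q) \<theta>\<^sub>0"
      by (rule lipschitz_onD) (use elim \<open>\<theta>\<^sub>0 \<in> U\<close> \<open>r > 0\<close> in \<open>auto simp: dist_commute\<close>)
    then show ?case
      using dist_triangle[of "x_star f q" "x_star f (\<theta>\<^sub>0, 0)" "x_star f (\<theta>\<^sub>0, snd q)"] by simp
  qed
  then have "((\<lambda>q. dist (x_star f q) (x_star f (\<theta>\<^sub>0, 0))) \<longlongrightarrow> 0) ?F"
    by (intro tendsto_sandwich[OF _ _ tendsto_const lim]) auto
  then show ?thesis
    by (simp add: continuous_within tendsto_dist_iff[symmetric])
qed

section \<open>Stability from uniform Lipschitz bounds\<close>

lemma stable_selectionI: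
  assumes reg: "regularity f \<Theta>" and "U \<subseteq> \<Theta>"
    and lip: "\<And>\<theta>\<^sub>0. \<theta>\<^sub>0 \<in> U \<Longrightarrow> \<exists>r>0. \<exists>e>0. \<exists>C. \<forall>\<epsilon>. 0 < \<epsilon> \<and> \<epsilon> \<le> e \<longrightarrow>
      C-lipschitz_on (ball \<theta>\<^sub>0 r \<inter> U) (x_reg f \<epsilon>)"
  shows "stable_selection f U"
proof -
  have "locally_lipschitz_on U (x_min f)"
    unfolding locally_lipschitz_on_def
  proof
    fix \<theta>\<^sub>0 assume "\<theta>\<^sub>0 \<in> U"
    then obtain r e C where "r > 0" "e > 0"
      and C: "\<And>\<epsilon>. 0 < \<epsilon> \<Longrightarrow> \<epsilon> \<le> e \<Longrightarrow> C-lipschitz_on (ball \<theta>\<^sub>0 r \<inter> U) (x_reg f \<epsilon>)"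
      using lip by metis
    have "C-lipschitz_on (ball \<theta>\<^sub>0 r \<inter> U) (\<lambda>\<theta>. x_star f (\<theta>, 0))"
      using \<open>U \<subseteq> \<Theta>\<close> \<open>e > 0\<close> by (intro x_star_lipschitz_on[OF reg _ C \<open>e > 0\<close>]) auto
    then show "\<exists>r>0. \<exists>L. L-lipschitz_on (ball \<theta>\<^sub>0 r \<inter> U) (x_min f)"
      using \<open>r > 0\<close> by (auto simp: x_star_def)
  qed
  moreover have cont: "continuous_on (U \<times> {0..}) (x_star f)"
    unfolding continuous_on_eq_continuous_within
  proof
    fix q assume "q \<in> U \<times> {0::real..}"
    then obtain \<theta>\<^sub>0 \<epsilon>\<^sub>0 where q: "q = (\<theta>\<^sub>0, \<epsilon>\<^sub>0)" "\<theta>\<^sub>0 \<in> U" "0 \<le> \<epsilon>\<^sub>0"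
      by auto
    show "continuous (at q within U \<times> {0..}) (x_star f)"
    proof (cases "\<epsilon>\<^sub>0 = 0")
      case True
      obtain r e C where "r > 0" "e > 0"
        and C: "\<And>\<epsilon>. 0 < \<epsilon> \<Longrightarrow> \<epsilon> \<le> e \<Longrightarrow> C-lipschitz_on (ball \<theta>\<^sub>0 r \<inter> U) (x_reg f \<epsilon>)"
        using lip[OF q(2)] by metis
      show ?thesis
        unfolding q(1) True
        by (rule continuous_x_star_zero[OF reg \<open>U \<subseteq> \<Theta>\<close> q(2) \<open>r > 0\<close> \<open>e > 0\<close> C])
    next
      case False
      then show ?thesis
        unfolding q(1) using q(2,3) by (intro continuous_x_star_positive[OF reg \<open>U \<subseteq> \<Theta>\<close>]) auto
    qed
  qed
  moreover have "uniform_limit K (x_reg f) (x_min f) (at_right 0)" if "compact K" "K \<subseteq> U" for K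
  proof (rule uniform_limitI)
    fix \<delta> :: real assume "\<delta> > 0"
    \<comment> \<open>Joint continuity on a compact strip gives uniform convergence; the upper end 1
      is an arbitrary choice.\<close>
    have "uniformly_continuous_on (K \<times> {0..1}) (x_star f)"
      using that by (intro compact_uniformly_continuous continuous_on_subset[OF cont] compact_Times) auto
    then obtain d where "d > 0" and d: "\<And>p q. p \<in> K \<times> {0..1} \<Longrightarrow> q \<in> K \<times> {0..1} \<Longrightarrow>
        dist q p < d \<Longrightarrow> dist (x_star f q) (x_star f p) < \<delta>"
      using \<open>\<delta> > 0\<close> unfolding uniformly_continuous_on_def by metis
    have "dist (x_reg f \<epsilon> \<theta>) (x_min f \<theta>) < \<delta>" if "0 < \<epsilon>" "\<epsilon> < min d 1" "\<theta> \<in> K" for \<epsilon> \<theta>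
      using d[of "(\<theta>, 0)" "(\<theta>, \<epsilon>)"] that by (simp add: x_star_def dist_Pair_Pair)
    then show "eventually (\<lambda>\<epsilon>. \<forall>\<theta>\<in>K. dist (x_reg f \<epsilon> \<theta>) (x_min f \<theta>) < \<delta>) (at_right 0)"
      unfolding eventually_at_right_field using \<open>d > 0\<close> by (intro exI[of _ "min d 1"]) auto
  qed
  ultimately show ?thesis
    unfolding stable_selection_def by blast
qed

text \<open>Closed balls inside \<open>U\<close> are compact and convex, so bounds along segments
  suffice locally.\<close>

lemma stable_selection_of_uniformly_lipschitz:
  assumes reg: "regularity f \<Theta>" and U: "open U" "U \<subseteq> \<Theta>"
    and lip: "\<And>K. compact K \<Longrightarrow> convex K \<Longrightarrow> K \<subseteq> U \<Longrightarrow>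
      \<exists>e>0. \<exists>C. \<forall>\<epsilon>. 0 < \<epsilon> \<and> \<epsilon> \<le> e \<longrightarrow> C-lipschitz_on K (x_reg f \<epsilon>)"
  shows "stable_selection f U"
proof (rule stable_selectionI[OF reg U(2)])
  fix \<theta>\<^sub>0 assume "\<theta>\<^sub>0 \<in> U"
  then obtain r where "r > 0" "cball \<theta>\<^sub>0 r \<subseteq> U"
    using U(1) open_contains_cball by blast
  then obtain e C where "e > 0" "\<And>\<epsilon>. 0 < \<epsilon> \<Longrightarrow> \<epsilon> \<le> e \<Longrightarrow> C-lipschitz_on (cball \<theta>\<^sub>0 r) (x_reg f \<epsilon>)"
    using lip[of "cball \<theta>\<^sub>0 r"] by auto
  then show "\<exists>r>0. \<exists>e>0. \<exists>C. \<forall>\<epsilon>. 0 < \<epsilon> \<and> \<epsilon> \<le> e \<longrightarrow> C-lipschitz_on (ball \<theta>\<^sub>0 r \<inter> U) (x_reg f \<epsilon>)"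
    using \<open>r > 0\<close> by (meson ball_subset_cball inf.coboundedI1 lipschitz_on_subset)
qed

theorem theorem5:
  fixes S :: "nat \<Rightarrow> real list set set"
    and f :: "real^'n \<Rightarrow> real^'m \<Rightarrow> real"
    and \<Theta> U :: "(real^'m) set"
  assumes "o_minimal_structure S"
    and "regularity f \<Theta>"
    and "definable S \<Theta>"
    and "definable S {(x, \<theta>, f x \<theta>) | x \<theta>. \<theta> \<in> \<Theta>}"
    and "open U" and "definable S U" and "U \<subseteq> \<Theta>"
  shows
    "(\<forall>J. (\<forall>\<epsilon>>0. conservative_jacobian U (x_reg f \<epsilon>) (J \<epsilon>)) \<and>
          (\<forall>K. compact K \<and> K \<subseteq> U \<longrightarrow> (\<exists>C>0. \<exists>\<epsilon>\<^sub>K>0. jacobian_bound J K \<epsilon>\<^sub>K C))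
        \<longrightarrow> stable_selection f U)
     \<and>
     (\<forall>\<epsilon>bar>0. \<forall>J\<^sub>F J.
          conservative_jacobian {z. \<theta>_part z \<in> U} (grad_x f) J\<^sub>F \<and>
          definable S {(z, V). \<theta>_part z \<in> U \<and> V \<in> J\<^sub>F z} \<and>
          uniform_range_condition f U \<epsilon>bar J\<^sub>F \<and>
          (\<forall>\<epsilon> \<theta>. 0 < \<epsilon> \<and> \<epsilon> \<le> \<epsilon>bar \<and> \<theta> \<in> U \<longrightarrow>
             J \<epsilon> \<theta> = {- (matrix_inv (x_block V + \<epsilon> *\<^sub>R mat 1) ** \<theta>_block V) | V.
                        V \<in> J\<^sub>F (joint (x_reg f \<epsilon> \<theta>) \<theta>)})
        \<longrightarrow> (\<forall>K. compact K \<and> K \<subseteq> U \<longrightarrow> (\<exists>C>0. jacobian_bound J K \<epsilon>bar C)) \<and>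
            stable_selection f U)"
proof (intro conjI allI impI; (elim conjE)?)
  fix J :: "real \<Rightarrow> real^'m \<Rightarrow> (real^'m^'n) set"
  assume J: "\<forall>\<epsilon>>0. conservative_jacobian U (x_reg f \<epsilon>) (J \<epsilon>)"
    and bound: "\<forall>K. compact K \<and> K \<subseteq> U \<longrightarrow> (\<exists>C>0. \<exists>\<epsilon>\<^sub>K>0. jacobian_bound J K \<epsilon>\<^sub>K C)"
  show "stable_selection f U"
  proof (rule stable_selection_of_uniformly_lipschitz[OF assms(2,5,7)])
    fix K assume K: "compact K" "convex K" "K \<subseteq> U"
    then obtain C e where "C > 0" "e > 0" and C: "jacobian_bound J K e C"
      using bound by blast
    have "C-lipschitz_on K (x_reg f \<epsilon>)" if "0 < \<epsilon>" "\<epsilon> \<le> e" for \<epsilon>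
      using J that K C \<open>C > 0\<close>
      by (intro conservative_jacobian_imp_lipschitz[where J = "J \<epsilon>" and U = U])
        (auto simp: jacobian_bound_def)
    then show "\<exists>e>0. \<exists>C. \<forall>\<epsilon>. 0 < \<epsilon> \<and> \<epsilon> \<le> e \<longrightarrow> C-lipschitz_on K (x_reg f \<epsilon>)"
      using \<open>e > 0\<close> by blast
  qed
next
  fix \<epsilon>bar :: real and J\<^sub>F J K
  assume range: "uniform_range_condition f U \<epsilon>bar J\<^sub>F"
    and J: "\<forall>\<epsilon> \<theta>. 0 < \<epsilon> \<and> \<epsilon> \<le> \<epsilon>bar \<and> \<theta> \<in> U \<longrightarrow>
             J \<epsilon> \<theta> = {- (matrix_inv (x_block V + \<epsilon> *\<^sub>R mat 1) ** \<theta>_block V) | V.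
                        V \<in> J\<^sub>F (joint (x_reg f \<epsilon> \<theta>) \<theta>)}"
    and K: "compact K" "K \<subseteq> U"
  \<comment> \<open>The constant of the range condition itself bounds the Jacobian elements, on the
    full range of \<open>\<epsilon>\<close> up to \<open>\<epsilon>bar\<close>.\<close>
  obtain C where "C > 0" and C: "\<And>\<theta> \<epsilon> V. \<theta> \<in> K \<Longrightarrow> 0 < \<epsilon> \<Longrightarrow> \<epsilon> \<le> \<epsilon>bar \<Longrightarrow>
      V \<in> J\<^sub>F (joint (x_reg f \<epsilon> \<theta>) \<theta>) \<Longrightarrow>
      (\<forall>v. 0 \<le> v \<bullet> (x_block V *v v)) \<and> (\<exists>W. \<theta>_block V = x_block V ** W \<and> op_norm W \<le> C)"
    using range K unfolding uniform_range_condition_def by metis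
  have "op_norm V' \<le> C" if \<theta>: "\<theta> \<in> K" and \<epsilon>: "0 < \<epsilon>" "\<epsilon> \<le> \<epsilon>bar" and V': "V' \<in> J \<epsilon> \<theta>" for \<theta> \<epsilon> V'
  proof -
    obtain V where V: "V \<in> J\<^sub>F (joint (x_reg f \<epsilon> \<theta>) \<theta>)"
      and V'_eq: "V' = - (matrix_inv (x_block V + \<epsilon> *\<^sub>R mat 1) ** \<theta>_block V)"
      using J \<theta> \<epsilon> V' K(2) by blast
    obtain W where "\<theta>_block V = x_block V ** W" "op_norm W \<le> C"
      using C[OF \<theta> \<epsilon> V] by blast
    then show ?thesis
      using op_norm_regularized_solution_le[of "x_block V" \<epsilon> W] C[OF \<theta> \<epsilon> V] \<epsilon>(1)
      unfolding V'_eq by auto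
  qed
  then show "\<exists>C>0. jacobian_bound J K \<epsilon>bar C"
    unfolding jacobian_bound_def using \<open>C > 0\<close> by blast
next
  fix \<epsilon>bar :: real and J\<^sub>F :: "real^('n + 'm) \<Rightarrow> (real^('n + 'm)^'n) set"
  assume "\<epsilon>bar > 0" and J\<^sub>F: "conservative_jacobian {z. \<theta>_part z \<in> U} (grad_x f) J\<^sub>F"
    and range: "uniform_range_condition f U \<epsilon>bar J\<^sub>F"
  \<comment> \<open>The Lipschitz bounds come from the chain rule for \<open>J\<^sub>F\<close> along
    lifted segments. Going through the family \<open>J\<close> would first require proving that it
    consists of conservative Jacobians.\<close>
  show "stable_selection f U"
  proof (rule stable_selection_of_uniformly_lipschitz[OF assms(2,5,7)])
    fix K assume K: "compact K" "convex K" "K \<subseteq> U"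
    obtain C where "C > 0" and C: "\<And>\<theta> \<epsilon> V. \<theta> \<in> K \<Longrightarrow> 0 < \<epsilon> \<Longrightarrow> \<epsilon> \<le> \<epsilon>bar \<Longrightarrow>
        V \<in> J\<^sub>F (joint (x_reg f \<epsilon> \<theta>) \<theta>) \<Longrightarrow>
        (\<forall>v. 0 \<le> v \<bullet> (x_block V *v v)) \<and> (\<exists>W. \<theta>_block V = x_block V ** W \<and> op_norm W \<le> C)"
      using range K unfolding uniform_range_condition_def by metis
    have "C-lipschitz_on K (x_reg f \<epsilon>)" if "0 < \<epsilon>" "\<epsilon> \<le> \<epsilon>bar" for \<epsilon>
      using \<open>C > 0\<close> that
      by (intro x_reg_lipschitz_of_range_condition[OF assms(2,7) _ _ J\<^sub>F K(2,1,3)] C) auto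
    then show "\<exists>e>0. \<exists>C. \<forall>\<epsilon>. 0 < \<epsilon> \<and> \<epsilon> \<le> e \<longrightarrow> C-lipschitz_on K (x_reg f \<epsilon>)"
      using \<open>\<epsilon>bar > 0\<close> by blast
  qed
qed

end
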